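(* Let $M^2$ be a minimal surface in the unit sphere $S^3\subset\mathbb R^4$ whose Gauss curvature is not constant. If on $M^2$ there exists a (one-parameter) family of circles crossing the principal lines of $M^2$ under a constant angle $\theta$, then the circles are either principal lines ($\theta=0$ or $\theta=\pi/2$) or bisectrices of the principal lines ($\theta=\pi/4$ or $\theta=3\pi/4$).
   Context: $\mathbb R^4$ carries the standard Euclidean inner product and $S^3$ is its unit sphere. A surface $M^2$ in $S^3$ is given locally by a smooth map $l(u,v)$ with $\langle l,l\rangle=1$; $n$ denotes a unit normal of $M^2$ in $S^3$ (orthogonal to $l,l_u,l_v$). $M^2$ is minimal in $S^3$ if its mean curvature with respect to $n$ vanishes. Principal lines are the lines of curvature (curves tangent to eigendirections of the shape operator associated with $n$); the bisectrices of the principal lines are the curves making angle $\pi/4$ with both families of principal lines. A circle means a curve in $\mathbb R^4$ with constant first Frenet curvature and vanishing higher Frenet curvatures. All considerations are local. *)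

theory Defs
  imports "HOL-Analysis.Analysis"
begin

definition pd_u :: "(real \<times> real \<Rightarrow> 'a::real_normed_vector) \<Rightarrow> real \<times> real \<Rightarrow> 'a" where
  "pd_u f p = frechet_derivative f (at p) (1, 0)"

definition pd_v :: "(real \<times> real \<Rightarrow> 'a::real_normed_vector) \<Rightarrow> real \<times> real \<Rightarrow> 'a" where
  "pd_v f p = frechet_derivative f (at p) (0, 1)"

fun Ck_on :: "nat \<Rightarrow> (real \<times> real) set \<Rightarrow> (real \<times> real \<Rightarrow> 'a::real_normed_vector) \<Rightarrow> bool" where
  "Ck_on 0 U f = continuous_on U f"
| "Ck_on (Suc k) U f = (f differentiable_on U \<and> Ck_on k U (pd_u f) \<and> Ck_on k U (pd_v f))"

definition smooth_on :: "(real \<times> real) set \<Rightarrow> (real \<times> real \<Rightarrow> 'a::real_normed_vector) \<Rightarrow> bool" where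
  "smooth_on U f = (\<forall>k. Ck_on k U f)"

definition fE :: "(real \<times> real \<Rightarrow> real^4) \<Rightarrow> real \<times> real \<Rightarrow> real" where
  "fE l p = pd_u l p \<bullet> pd_u l p"
definition fF :: "(real \<times> real \<Rightarrow> real^4) \<Rightarrow> real \<times> real \<Rightarrow> real" where
  "fF l p = pd_u l p \<bullet> pd_v l p"
definition fG :: "(real \<times> real \<Rightarrow> real^4) \<Rightarrow> real \<times> real \<Rightarrow> real" where
  "fG l p = pd_v l p \<bullet> pd_v l p"

definition sL :: "(real \<times> real \<Rightarrow> real^4) \<Rightarrow> (real \<times> real \<Rightarrow> real^4) \<Rightarrow> real \<times> real \<Rightarrow> real" where
  "sL l n p = pd_u (pd_u l) p \<bullet> n p"
definition sM :: "(real \<times> real \<Rightarrow> real^4) \<Rightarrow> (real \<times> real \<Rightarrow> real^4) \<Rightarrow> real \<times> real \<Rightarrow> real" where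
  "sM l n p = pd_v (pd_u l) p \<bullet> n p"
definition sN :: "(real \<times> real \<Rightarrow> real^4) \<Rightarrow> (real \<times> real \<Rightarrow> real^4) \<Rightarrow> real \<times> real \<Rightarrow> real" where
  "sN l n p = pd_v (pd_v l) p \<bullet> n p"

definition mean_curv :: "(real \<times> real \<Rightarrow> real^4) \<Rightarrow> (real \<times> real \<Rightarrow> real^4) \<Rightarrow> real \<times> real \<Rightarrow> real" where
  "mean_curv l n p =
     (fE l p * sN l n p - 2 * fF l p * sM l n p + fG l p * sL l n p)
       / (2 * (fE l p * fG l p - (fF l p)\<^sup>2))"

text \<open>Gauss curvature of M^2 (intrinsic), given by the Gauss equation in S^3: K = 1 + det(II)/det(I).\<close>
definition gauss_curv :: "(real \<times> real \<Rightarrow> real^4) \<Rightarrow> (real \<times> real \<Rightarrow> real^4) \<Rightarrow> real \<times> real \<Rightarrow> real" where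
  "gauss_curv l n p =
     1 + (sL l n p * sN l n p - (sM l n p)\<^sup>2) / (fE l p * fG l p - (fF l p)\<^sup>2)"

definition surface_in_S3 :: "(real \<times> real) set \<Rightarrow> (real \<times> real \<Rightarrow> real^4) \<Rightarrow> (real \<times> real \<Rightarrow> real^4) \<Rightarrow> bool" where
  "surface_in_S3 U l n \<longleftrightarrow>
     open U \<and> smooth_on U l \<and> smooth_on U n \<and>
     (\<forall>p\<in>U. l p \<bullet> l p = 1 \<and> independent {pd_u l p, pd_v l p} \<and> pd_u l p \<noteq> pd_v l p \<and>
            n p \<bullet> n p = 1 \<and> n p \<bullet> l p = 0 \<and> n p \<bullet> pd_u l p = 0 \<and> n p \<bullet> pd_v l p = 0)"

definition minimal_in_S3 :: "(real \<times> real) set \<Rightarrow> (real \<times> real \<Rightarrow> real^4) \<Rightarrow> (real \<times> real \<Rightarrow> real^4) \<Rightarrow> bool" where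
  "minimal_in_S3 U l n \<longleftrightarrow> (\<forall>p\<in>U. mean_curv l n p = 0)"

text \<open>w is a principal direction at p: a nonzero tangent vector w = a l_u + b l_v that is an
  eigenvector of the shape operator, i.e. II((a,b),.) = k I((a,b),.).\<close>
definition principal_direction :: "(real \<times> real \<Rightarrow> real^4) \<Rightarrow> (real \<times> real \<Rightarrow> real^4) \<Rightarrow> real \<times> real \<Rightarrow> real^4 \<Rightarrow> bool" where
  "principal_direction l n p w \<longleftrightarrow> w \<noteq> 0 \<and>
     (\<exists>a b k. w = a *\<^sub>R pd_u l p + b *\<^sub>R pd_v l p \<and>
        sL l n p * a + sM l n p * b = k * (fE l p * a + fF l p * b) \<and>
        sM l n p * a + sN l n p * b = k * (fF l p * a + fG l p * b))"

definition vd :: "(real \<Rightarrow> real^4) \<Rightarrow> real \<Rightarrow> real^4" where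
  "vd g t = vector_derivative g (at t)"

definition frenet_kappa1 :: "(real \<Rightarrow> real^4) \<Rightarrow> real \<Rightarrow> real" where
  "frenet_kappa1 g t =
     sqrt ((norm (vd g t))\<^sup>2 * (norm (vd (vd g) t))\<^sup>2 - (vd g t \<bullet> vd (vd g) t)\<^sup>2)
       / (norm (vd g t)) ^ 3"

text \<open>A circle: a regular C^3 curve on an open interval with constant first Frenet curvature
  and vanishing higher Frenet curvatures (when kappa1 is nonzero, the second Frenet curvature
  vanishes iff g''' lies in the span of g', g''; the higher ones are then zero as well).\<close>
definition is_circle :: "real set \<Rightarrow> (real \<Rightarrow> real^4) \<Rightarrow> bool" where
  "is_circle I g \<longleftrightarrow>
     (\<forall>t\<in>I. g differentiable at t \<and> vd g differentiable at t \<and> vd (vd g) differentiable at t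
            \<and> vd g t \<noteq> 0) \<and>
     (\<exists>k. \<forall>t\<in>I. frenet_kappa1 g t = k) \<and>
     (\<forall>t\<in>I. frenet_kappa1 g t \<noteq> 0 \<longrightarrow> vd (vd (vd g)) t \<in> span {vd g t, vd (vd g) t})"

end

theory Submission
  imports Defs
begin

text \<open>At a point with \<open>K \<noteq> 1\<close> the surface is not umbilic, and the unit tangent field \<open>X\<close> of the
  circles is smooth nearby. Let \<open>\<plusminus>\<mu>\<close> be the principal curvatures, \<open>c = cos 2\<theta>\<close>,
  \<open>s = sin 2\<theta>\<close>, and let \<open>a\<close>, \<open>b\<close> be the geodesic curvature functions of the orthonormal
  frame \<open>X\<close>, \<open>Y\<close>. The Codazzi equations give \<open>X\<mu> = -2b\<mu>\<close> and \<open>Y\<mu> = 2a\<mu>\<close>, and the integral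
  curves of \<open>X\<close> are circles only if \<open>Xa = -\<mu>\<^sup>2cs\<close> and \<open>cX\<mu> = a\<mu>s\<close>. If \<open>c\<close> and \<open>s\<close> are both
  nonzero, then \<open>a\<close> is a constant multiple of \<open>b\<close>, the bracket \<open>[X, Y]\<mu>\<close> gives \<open>Yb\<close>, and the
  Gauss equation becomes an algebraic relation between \<open>b\<^sup>2\<close> and \<open>\<mu>\<^sup>2\<close>. Its derivative along
  \<open>X\<close> forces \<open>b = 0\<close>, hence \<open>0 = 2Xb = s\<^sup>2\<mu>\<^sup>2\<close>, a contradiction. So \<open>sin 4\<theta> = 0\<close>.\<close>

section \<open>Calculus of smooth functions on the plane\<close>

lemma open_differentiable_at:
  assumes "open U" "f differentiable_on U" "p \<in> U"
  shows "f differentiable (at p)"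
  using assms(2,3) at_within_open[OF assms(3,1)] unfolding differentiable_on_def by metis

lemma Ck_on_Suc_differentiable:
  "open U \<Longrightarrow> Ck_on (Suc k) U f \<Longrightarrow> p \<in> U \<Longrightarrow> f differentiable (at p)"
  using open_differentiable_at by auto

lemma frechet_derivative_cong_open:
  assumes "open U" "p \<in> U" "\<And>x. x \<in> U \<Longrightarrow> f x = g x" "f differentiable (at p)"
  shows "g differentiable (at p)" "frechet_derivative g (at p) = frechet_derivative f (at p)"
proof -
  have "(f has_derivative frechet_derivative f (at p)) (at p)"
    using assms(4) frechet_derivative_works by blast
  then have "(g has_derivative frechet_derivative f (at p)) (at p)"
    using assms has_derivative_transform_within_open by blast
  then show "g differentiable (at p)" "frechet_derivative g (at p) = frechet_derivative f (at p)"
    using frechet_derivative_at[of g] by (auto simp: differentiable_def)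
qed

lemma Ck_on_imp_continuous_on: "Ck_on k U f \<Longrightarrow> continuous_on U f"
  by (cases k) (auto intro: differentiable_imp_continuous_on)

lemma Ck_on_SucD:
  "Ck_on (Suc k) U f \<Longrightarrow> Ck_on k U (pd_u f)" "Ck_on (Suc k) U f \<Longrightarrow> Ck_on k U (pd_v f)"
  by simp_all

lemma Ck_on_Suc_imp: "Ck_on (Suc k) U f \<Longrightarrow> Ck_on k U f"
proof (induction k arbitrary: f)
  case 0
  then show ?case by (auto intro: differentiable_imp_continuous_on)
next
  case (Suc k)
  then show ?case by (metis Ck_on.simps(2))
qed

text \<open>\<open>pd_u\<close> and \<open>pd_v\<close> are derivatives at a point of the whole
  plane; openness of U lets an identity that holds on U alone be differentiated there.\<close>

lemma Ck_on_cong: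
  assumes "open U" "Ck_on k U f" "\<And>x. x \<in> U \<Longrightarrow> f x = g x"
  shows "Ck_on k U g"
  using assms(2,3)
proof (induction k arbitrary: f g)
  case 0
  then show ?case by (simp cong: continuous_on_cong)
next
  case (Suc k)
  have d: "f differentiable (at p)" if "p \<in> U" for p
    using Suc.prems that Ck_on_Suc_differentiable[OF assms(1)] by blast
  have "g differentiable (at p)" "pd_u g p = pd_u f p" "pd_v g p = pd_v f p" if "p \<in> U" for p
    using frechet_derivative_cong_open[OF assms(1) that, of f g] Suc.prems(2) d[OF that]
    unfolding pd_u_def pd_v_def by auto
  moreover have "Ck_on k U (pd_u g)" "Ck_on k U (pd_v g)"
    using calculation(2,3) Suc.prems(1) by (auto intro: Suc.IH[of "pd_u f"] Suc.IH[of "pd_v f"])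
  ultimately show ?case
    by (simp add: differentiable_on_def differentiable_at_withinI)
qed

text \<open>Inductions on the order run through this rule: explicit formulas for the two partial
  derivatives, valid on U, stand in for \<open>pd_u g\<close> and \<open>pd_v g\<close>.\<close>

lemma Ck_on_SucI:
  assumes "open U" "Ck_on k U gu" "Ck_on k U gv"
    and "\<And>p. p \<in> U \<Longrightarrow> g differentiable (at p)"
    and "\<And>p. p \<in> U \<Longrightarrow> pd_u g p = gu p" "\<And>p. p \<in> U \<Longrightarrow> pd_v g p = gv p"
  shows "Ck_on (Suc k) U g"
proof -
  have "Ck_on k U (pd_u g)" "Ck_on k U (pd_v g)"
    by (rule Ck_on_cong[OF assms(1)], rule assms, simp add: assms)+
  then show ?thesis
    using assms(4) by (simp add: differentiable_on_def differentiable_at_withinI)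
qed

lemma Ck_on_subset:
  assumes "Ck_on k U f" "V \<subseteq> U"
  shows "Ck_on k V f"
  using assms by (induction k arbitrary: f)
    (auto intro: continuous_on_subset simp: differentiable_on_subset)

lemma pd_const [simp]: "pd_u (\<lambda>_. c) = (\<lambda>_. 0)" "pd_v (\<lambda>_. c) = (\<lambda>_. 0)"
  by (auto simp: pd_u_def pd_v_def)

lemma Ck_on_const: "Ck_on k U (\<lambda>_. c)"
  by (induction k arbitrary: c) auto

lemma pd_bilinear:
  assumes "bounded_bilinear B" "f differentiable (at p)" "g differentiable (at p)"
  shows "(\<lambda>x. B (f x) (g x)) differentiable (at p)"
    "pd_u (\<lambda>x. B (f x) (g x)) p = B (f p) (pd_u g p) + B (pd_u f p) (g p)"
    "pd_v (\<lambda>x. B (f x) (g x)) p = B (f p) (pd_v g p) + B (pd_v f p) (g p)"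
proof -
  have "((\<lambda>x. B (f x) (g x)) has_derivative
      (\<lambda>h. B (f p) (frechet_derivative g (at p) h) + B (frechet_derivative f (at p) h) (g p))) (at p)"
    using assms(2,3) by (intro bounded_bilinear.FDERIV[OF assms(1)])
      (simp_all add: frechet_derivative_works[symmetric])
  then show "(\<lambda>x. B (f x) (g x)) differentiable (at p)"
    "pd_u (\<lambda>x. B (f x) (g x)) p = B (f p) (pd_u g p) + B (pd_u f p) (g p)"
    "pd_v (\<lambda>x. B (f x) (g x)) p = B (f p) (pd_v g p) + B (pd_v f p) (g p)"
    by (auto simp: pd_u_def pd_v_def differentiable_def frechet_derivative_at[symmetric])
qed

lemma Ck_on_add:
  assumes U: "open U" and "Ck_on k U f" "Ck_on k U g"
  shows "Ck_on k U (\<lambda>x. f x + g x)"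
  using assms(2,3)
proof (induction k arbitrary: f g)
  case (Suc k)
  have d: "f differentiable (at p)" "g differentiable (at p)" if "p \<in> U" for p
    using Suc.prems that Ck_on_Suc_differentiable[OF U] by blast+
  have e: "pd_u (\<lambda>x. f x + g x) p = pd_u f p + pd_u g p" "pd_v (\<lambda>x. f x + g x) p = pd_v f p + pd_v g p"
    if "p \<in> U" for p
  proof -
    have "((\<lambda>x. f x + g x) has_derivative
        (\<lambda>h. frechet_derivative f (at p) h + frechet_derivative g (at p) h)) (at p)"
      using d[OF that] by (auto intro!: has_derivative_add simp: frechet_derivative_works[symmetric])
    then show "pd_u (\<lambda>x. f x + g x) p = pd_u f p + pd_u g p"
      "pd_v (\<lambda>x. f x + g x) p = pd_v f p + pd_v g p"
      by (auto simp: pd_u_def pd_v_def frechet_derivative_at[symmetric])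
  qed
  show ?case
    by (rule Ck_on_SucI[OF U Suc.IH Suc.IH]) (use Suc.prems d e in \<open>auto intro: differentiable_add\<close>)
qed (auto intro: continuous_on_add)

text \<open>One induction serves products, inner products and scalar multiples: by the Leibniz rule
  each partial derivative is a sum of two B-terms whose arguments have order k.\<close>

lemma Ck_on_bilinear:
  assumes U: "open U" and B: "bounded_bilinear B" and "Ck_on k U f" "Ck_on k U g"
  shows "Ck_on k U (\<lambda>x. B (f x) (g x))"
  using assms(3,4)
proof (induction k arbitrary: f g)
  case 0
  then show ?case using bounded_bilinear.continuous_on[OF B] by auto
next
  case (Suc k)
  have d: "f differentiable (at p)" "g differentiable (at p)" if "p \<in> U" for p
    using Suc.prems that Ck_on_Suc_differentiable[OF U] by blast+
  have l: "Ck_on k U f" "Ck_on k U g" using Suc.prems Ck_on_Suc_imp by blast+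
  have "Ck_on k U (\<lambda>x. B (f x) (pd_u g x) + B (pd_u f x) (g x))"
    "Ck_on k U (\<lambda>x. B (f x) (pd_v g x) + B (pd_v f x) (g x))"
    by (intro Ck_on_add[OF U] Suc.IH l Ck_on_SucD Suc.prems)+
  then show ?case
    by (rule Ck_on_SucI[OF U]) (simp_all add: pd_bilinear[OF B] d)
qed

lemma pd_chain:
  assumes "f differentiable (at p)" "(\<phi> has_field_derivative d) (at (f p))"
  shows "(\<lambda>x. \<phi> (f x)) differentiable (at p)"
    "pd_u (\<lambda>x. \<phi> (f x)) p = d * pd_u f p" "pd_v (\<lambda>x. \<phi> (f x)) p = d * pd_v f p"
proof -
  have "((\<lambda>x. \<phi> (f x)) has_derivative (\<lambda>h. d * frechet_derivative f (at p) h)) (at p)"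
    using has_derivative_compose[of f "frechet_derivative f (at p)" p UNIV \<phi> "(*) d"] assms
    by (simp add: frechet_derivative_works[symmetric] has_field_derivative_def)
  then show "(\<lambda>x. \<phi> (f x)) differentiable (at p)"
    "pd_u (\<lambda>x. \<phi> (f x)) p = d * pd_u f p" "pd_v (\<lambda>x. \<phi> (f x)) p = d * pd_v f p"
    by (auto simp: pd_u_def pd_v_def differentiable_def frechet_derivative_at[symmetric])
qed

text \<open>The outer derivative \<psi>, evaluated along f, is needed to one order less than the
  result. For the reciprocal and the square root \<psi> is expressed through \<phi> itself, so an
  induction on the order closes.\<close>

lemma Ck_on_chain:
  assumes U: "open U" and "Ck_on (Suc k) U f" "Ck_on k U (\<lambda>x. \<psi> (f x))"
    and der: "\<And>x. x \<in> U \<Longrightarrow> (\<phi> has_field_derivative \<psi> (f x)) (at (f x))"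
  shows "Ck_on (Suc k) U (\<lambda>x. \<phi> (f x))"
proof -
  have d: "f differentiable (at p)" if "p \<in> U" for p
    using assms that Ck_on_Suc_differentiable[OF U] by blast
  have "Ck_on k U (\<lambda>x. \<psi> (f x) * pd_u f x)" "Ck_on k U (\<lambda>x. \<psi> (f x) * pd_v f x)"
    by (intro Ck_on_bilinear[OF U bounded_bilinear_mult] Ck_on_SucD assms)+
  then show ?thesis
    by (rule Ck_on_SucI[OF U]) (simp_all add: pd_chain[OF d der])
qed

lemma Ck_on_inverse:
  fixes f :: "real \<times> real \<Rightarrow> real"
  assumes U: "open U" and "Ck_on k U f" "\<And>x. x \<in> U \<Longrightarrow> f x \<noteq> 0"
  shows "Ck_on k U (\<lambda>x. inverse (f x))"
  using assms(2)
proof (induction k)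
  case 0
  then show ?case using assms(3) by (auto intro!: continuous_on_inverse)
next
  case (Suc k)
  have i: "Ck_on k U (\<lambda>x. inverse (f x))" using Suc Ck_on_Suc_imp by blast
  have "Ck_on k U (\<lambda>x. (-1) * (inverse (f x) * inverse (f x)))"
    by (intro Ck_on_bilinear[OF U bounded_bilinear_mult] i Ck_on_const)
  then show ?case
    by (rule Ck_on_chain[OF U Suc.prems, where \<psi> = "\<lambda>y. (-1) * (inverse y * inverse y)"])
      (use assms(3) in \<open>auto intro!: derivative_eq_intros\<close>)
qed

lemma Ck_on_sqrt:
  fixes f :: "real \<times> real \<Rightarrow> real"
  assumes U: "open U" and "Ck_on k U f" "\<And>x. x \<in> U \<Longrightarrow> f x > 0"
  shows "Ck_on k U (\<lambda>x. sqrt (f x))"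
  using assms(2)
proof (induction k)
  case 0
  then show ?case by (auto intro!: continuous_intros)
next
  case (Suc k)
  have "Ck_on k U (\<lambda>x. sqrt (f x))" using Suc Ck_on_Suc_imp by blast
  then have "Ck_on k U (\<lambda>x. 2 * sqrt (f x))"
    by (intro Ck_on_bilinear[OF U bounded_bilinear_mult] Ck_on_const)
  moreover have "2 * sqrt (f x) \<noteq> 0" if "x \<in> U" for x using assms(3)[OF that] by simp
  ultimately have i: "Ck_on k U (\<lambda>x. inverse (2 * sqrt (f x)))" by (rule Ck_on_inverse[OF U])
  have "(sqrt has_field_derivative inverse (2 * sqrt (f x))) (at (f x))" if "x \<in> U" for x
    using DERIV_real_sqrt[OF assms(3)[OF that]] by (simp add: field_simps)
  then show ?case
    using Ck_on_chain[where \<psi> = "\<lambda>y. inverse (2 * sqrt y)", OF U Suc.prems i] by blast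
qed

section \<open>Closure properties of smooth functions\<close>

lemma smooth_on_const: "smooth_on U (\<lambda>_. c)"
  by (simp add: smooth_on_def Ck_on_const)

lemma smooth_on_add: "open U \<Longrightarrow> smooth_on U f \<Longrightarrow> smooth_on U g \<Longrightarrow> smooth_on U (\<lambda>x. f x + g x)"
  by (simp add: smooth_on_def Ck_on_add)

lemma smooth_on_bilinear:
  "bounded_bilinear B \<Longrightarrow> open U \<Longrightarrow> smooth_on U f \<Longrightarrow> smooth_on U g \<Longrightarrow> smooth_on U (\<lambda>x. B (f x) (g x))"
  by (simp add: smooth_on_def Ck_on_bilinear)

lemmas smooth_on_mult = smooth_on_bilinear[OF bounded_bilinear_mult]
lemmas smooth_on_inner = smooth_on_bilinear[OF bounded_bilinear_inner]
lemmas smooth_on_scaleR = smooth_on_bilinear[OF bounded_bilinear_scaleR]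

lemma smooth_on_minus:
  assumes "open U" "smooth_on U f" shows "smooth_on U (\<lambda>x. - f x)"
  using smooth_on_scaleR[OF assms(1) smooth_on_const assms(2), of "-1"] by simp

lemma smooth_on_diff: "open U \<Longrightarrow> smooth_on U f \<Longrightarrow> smooth_on U g \<Longrightarrow> smooth_on U (\<lambda>x. f x - g x)"
  using smooth_on_add[of U f "\<lambda>x. - g x"] smooth_on_minus[of U g] by simp

lemma smooth_on_divide:
  fixes f g :: "real \<times> real \<Rightarrow> real"
  assumes "open U" "smooth_on U f" "smooth_on U g" "\<And>x. x \<in> U \<Longrightarrow> g x \<noteq> 0"
  shows "smooth_on U (\<lambda>x. f x / g x)"
  unfolding divide_inverse
  by (rule smooth_on_mult) (use assms Ck_on_inverse in \<open>auto simp: smooth_on_def\<close>)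

lemma smooth_on_sqrt:
  "open U \<Longrightarrow> smooth_on U f \<Longrightarrow> (\<And>x. x \<in> U \<Longrightarrow> f x > 0) \<Longrightarrow> smooth_on U (\<lambda>x. sqrt (f x))"
  by (simp add: smooth_on_def Ck_on_sqrt)

lemma smooth_on_pd: "smooth_on U f \<Longrightarrow> smooth_on U (pd_u f)" "smooth_on U f \<Longrightarrow> smooth_on U (pd_v f)"
  unfolding smooth_on_def by (meson Ck_on_SucD)+

lemmas smooth_on_intros = smooth_on_const smooth_on_add smooth_on_mult smooth_on_inner smooth_on_scaleR
  smooth_on_minus smooth_on_diff smooth_on_pd

lemma smooth_on_cong:
  "open U \<Longrightarrow> smooth_on U f \<Longrightarrow> (\<And>x. x \<in> U \<Longrightarrow> f x = g x) \<Longrightarrow> smooth_on U g"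
  unfolding smooth_on_def using Ck_on_cong by blast

lemma smooth_on_subset: "smooth_on U f \<Longrightarrow> V \<subseteq> U \<Longrightarrow> smooth_on V f"
  unfolding smooth_on_def using Ck_on_subset by blast

lemma smooth_on_imp_continuous_on: "smooth_on U f \<Longrightarrow> continuous_on U f"
  unfolding smooth_on_def using Ck_on_imp_continuous_on by blast

lemma smooth_on_imp_differentiable:
  "open U \<Longrightarrow> smooth_on U f \<Longrightarrow> p \<in> U \<Longrightarrow> f differentiable (at p)"
  unfolding smooth_on_def using Ck_on_Suc_differentiable by blast

text \<open>Near a point where f does not vanish, f is a constant sign times the root of its square.
  This upgrades quantities known up to sign from continuous to smooth.\<close>

lemma smooth_on_of_square:
  fixes f :: "real \<times> real \<Rightarrow> real"
  assumes V: "open V" and cont: "continuous_on V f" and sq: "smooth_on V (\<lambda>x. f x * f x)"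
    and p: "p \<in> V" "f p \<noteq> 0"
  shows "\<exists>W. open W \<and> p \<in> W \<and> W \<subseteq> V \<and> smooth_on W f \<and> (\<forall>x\<in>W. f x \<noteq> 0)"
proof -
  \<comment> \<open>The part of V where f has the same sign as at p; it is open by
    continuity.\<close>
  define W where "W = V \<inter> (\<lambda>x. f p * f x) -` {0<..}"
  have W: "open W"
    unfolding W_def by (intro continuous_open_preimage V open_greaterThan continuous_intros cont)
  have sub: "W \<subseteq> V" "p \<in> W" using p by (auto simp: W_def zero_less_mult_iff)
  have nz: "f x \<noteq> 0" if "x \<in> W" for x using that by (auto simp: W_def)
  have "smooth_on W (\<lambda>x. sqrt (f x * f x))"
  proof (rule smooth_on_sqrt[OF W smooth_on_subset[OF sq sub(1)]])
    show "0 < f x * f x" if "x \<in> W" for x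
      using nz[OF that] not_real_square_gt_zero by blast
  qed
  then have "smooth_on W (\<lambda>x. sgn (f p) * sqrt (f x * f x))"
    by (intro smooth_on_mult W smooth_on_const)
  moreover have "sgn (f p) * sqrt (f x * f x) = f x" if "x \<in> W" for x
    using that by (auto simp: W_def zero_less_mult_iff)
  ultimately have "smooth_on W f" using smooth_on_cong[OF W] by blast
  then show ?thesis using W sub nz by blast
qed

section \<open>Mixed partial derivatives and directional derivatives\<close>

lemma DERIV_pd:
  assumes "f differentiable (at (x, y))"
  shows "((\<lambda>x. f (x, y)) has_real_derivative pd_u f (x, y)) (at x)"
    and "((\<lambda>y. f (x, y)) has_real_derivative pd_v f (x, y)) (at y)"
proof -
  have f: "(f has_derivative frechet_derivative f (at (x, y))) (at (x, y))"
    using assms frechet_derivative_works by blast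
  have lin: "linear (frechet_derivative f (at (x, y)))"
    using assms linear_frechet_derivative by blast
  have "((\<lambda>x. f (x, y)) has_derivative (\<lambda>h. frechet_derivative f (at (x, y)) (h, 0))) (at x)"
    by (rule has_derivative_compose[where f = "\<lambda>x. (x, y)"]) (auto intro!: derivative_eq_intros f)
  moreover have "frechet_derivative f (at (x, y)) (h, 0) = h * pd_u f (x, y)" for h
    using linear_scale[OF lin, of h "(1, 0)"] by (simp add: pd_u_def)
  ultimately show "((\<lambda>x. f (x, y)) has_real_derivative pd_u f (x, y)) (at x)"
    by (auto intro: has_derivative_imp_has_field_derivative)
  have "((\<lambda>y. f (x, y)) has_derivative (\<lambda>h. frechet_derivative f (at (x, y)) (0, h))) (at y)"
    by (rule has_derivative_compose[where f = "\<lambda>y. (x, y)"]) (auto intro!: derivative_eq_intros f)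
  moreover have "frechet_derivative f (at (x, y)) (0, h) = h * pd_v f (x, y)" for h
    using linear_scale[OF lin, of h "(0, 1)"] by (simp add: pd_v_def)
  ultimately show "((\<lambda>y. f (x, y)) has_real_derivative pd_v f (x, y)) (at y)"
    by (auto intro: has_derivative_imp_has_field_derivative)
qed

text \<open>The mean value theorem is applied twice to the second difference of f over a square,
  once for each order of the variables.\<close>

lemma second_difference_mvt:
  fixes f :: "real \<times> real \<Rightarrow> real"
  assumes h: "h > 0" and box: "{a..a+h} \<times> {b..b+h} \<subseteq> U"
    and f: "\<And>p. p \<in> U \<Longrightarrow> f differentiable (at p)"
    and fu: "\<And>p. p \<in> U \<Longrightarrow> pd_u f differentiable (at p)"
    and fv: "\<And>p. p \<in> U \<Longrightarrow> pd_v f differentiable (at p)"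
  obtains P Q where "P \<in> {a..a+h} \<times> {b..b+h}" "Q \<in> {a..a+h} \<times> {b..b+h}"
    "pd_v (pd_u f) P = pd_u (pd_v f) Q"
proof -
  let ?\<Delta> = "f (a+h, b+h) - f (a+h, b) - f (a, b+h) + f (a, b)"
  have inU: "(x, y) \<in> U" if "a \<le> x" "x \<le> a+h" "b \<le> y" "y \<le> b+h" for x y
    using box that by auto
  have "((\<lambda>x. f (x, b+h) - f (x, b)) has_real_derivative (pd_u f (x, b+h) - pd_u f (x, b))) (at x)"
    if "a \<le> x" "x \<le> a+h" for x
    using that h by (intro DERIV_diff DERIV_pd f inU) auto
  from MVT2[OF _ this, of a "a+h"] h obtain x where x: "a < x" "x < a+h"
    "?\<Delta> = h * (pd_u f (x, b+h) - pd_u f (x, b))" by (auto simp: algebra_simps)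
  have "((\<lambda>y. pd_u f (x, y)) has_real_derivative pd_v (pd_u f) (x, y)) (at y)"
    if "b \<le> y" "y \<le> b+h" for y using that x h by (intro DERIV_pd fu inU) auto
  from MVT2[OF _ this, of b "b+h"] h obtain y where y: "b < y" "y < b+h"
    "pd_u f (x, b+h) - pd_u f (x, b) = h * pd_v (pd_u f) (x, y)" by auto
  have "((\<lambda>y. f (a+h, y) - f (a, y)) has_real_derivative (pd_v f (a+h, y) - pd_v f (a, y))) (at y)"
    if "b \<le> y" "y \<le> b+h" for y
    using that h by (intro DERIV_diff DERIV_pd f inU) auto
  from MVT2[OF _ this, of b "b+h"] h obtain y' where y': "b < y'" "y' < b+h"
    "?\<Delta> = h * (pd_v f (a+h, y') - pd_v f (a, y'))" by (auto simp: algebra_simps)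
  have "((\<lambda>x. pd_v f (x, y')) has_real_derivative pd_u (pd_v f) (x, y')) (at x)"
    if "a \<le> x" "x \<le> a+h" for x using that y' h by (intro DERIV_pd fv inU) auto
  from MVT2[OF _ this, of a "a+h"] h obtain x' where x': "a < x'" "x' < a+h"
    "pd_v f (a+h, y') - pd_v f (a, y') = h * pd_u (pd_v f) (x', y')" by auto
  have "pd_v (pd_u f) (x, y) = pd_u (pd_v f) (x', y')"
    using x(3) y(3) y'(3) x'(3) h by auto
  then show thesis
    using that[of "(x, y)" "(x', y')"] x(1,2) y(1,2) x'(1,2) y'(1,2) by simp
qed

text \<open>Schwarz's theorem: every small square at p contains points where the two mixed
  derivatives share a value, and both are continuous.\<close>

lemma pd_mixed_real:
  fixes f :: "real \<times> real \<Rightarrow> real"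
  assumes U: "open U" and f: "smooth_on U f" and p: "p \<in> U"
  shows "pd_v (pd_u f) p = pd_u (pd_v f) p"
proof (rule ccontr)
  obtain a b where ab: "p = (a, b)" by (cases p)
  \<comment> \<open>Half the supposed gap: values closer than this to the two mixed derivatives at p
    cannot coincide.\<close>
  define e where "e = \<bar>pd_v (pd_u f) p - pd_u (pd_v f) p\<bar> / 2"
  assume "pd_v (pd_u f) p \<noteq> pd_u (pd_v f) p"
  then have e: "e > 0" by (simp add: e_def)
  have "isCont (pd_v (pd_u f)) p" "isCont (pd_u (pd_v f)) p"
    using smooth_on_imp_continuous_on[of U] smooth_on_pd f U p continuous_on_eq_continuous_at by blast+
  then have "\<exists>d>0. \<forall>q. dist q p < d \<longrightarrow> dist (pd_v (pd_u f) q) (pd_v (pd_u f) p) < e"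
    "\<exists>d>0. \<forall>q. dist q p < d \<longrightarrow> dist (pd_u (pd_v f) q) (pd_u (pd_v f) p) < e"
    using e by (simp_all add: continuous_at_eps_delta)
  then obtain d1 d2 where d: "d1 > 0" "d2 > 0"
    "\<And>q. dist q p < d1 \<Longrightarrow> dist (pd_v (pd_u f) q) (pd_v (pd_u f) p) < e"
    "\<And>q. dist q p < d2 \<Longrightarrow> dist (pd_u (pd_v f) q) (pd_u (pd_v f) p) < e"
    by blast
  obtain d3 where d3: "d3 > 0" "ball p d3 \<subseteq> U" using U p open_contains_ball by blast
  \<comment> \<open>Points of the square of side h are within 2h of p, hence strictly within
    3h.\<close>
  define h where "h = min (min d1 d2) d3 / 3"
  have h: "h > 0" using d d3 by (simp add: h_def)
  have near: "dist q p < min (min d1 d2) d3" if "q \<in> {a..a+h} \<times> {b..b+h}" for q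
  proof -
    obtain x y where q: "q = (x, y)" by (cases q)
    have "dist q p \<le> dist x a + dist y b"
      unfolding q ab dist_Pair_Pair by (rule sqrt_sum_squares_le_sum) auto
    also have "\<dots> \<le> h + h" using that by (auto simp: q dist_real_def)
    also have "\<dots> < min (min d1 d2) d3" using h unfolding h_def by linarith
    finally show ?thesis .
  qed
  have "{a..a+h} \<times> {b..b+h} \<subseteq> U"
  proof
    fix q assume "q \<in> {a..a+h} \<times> {b..b+h}"
    from near[OF this] have "q \<in> ball p d3" by (simp add: dist_commute)
    then show "q \<in> U" using d3(2) by blast
  qed
  then obtain P Q where PQ: "P \<in> {a..a+h} \<times> {b..b+h}" "Q \<in> {a..a+h} \<times> {b..b+h}"
    "pd_v (pd_u f) P = pd_u (pd_v f) Q"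
    using second_difference_mvt[OF h, of a b U f thesis] smooth_on_imp_differentiable[OF U] smooth_on_pd f
    by metis
  have "dist (pd_v (pd_u f) P) (pd_v (pd_u f) p) < e" "dist (pd_u (pd_v f) Q) (pd_u (pd_v f) p) < e"
    using d(3,4) near[OF PQ(1)] near[OF PQ(2)] by auto
  then show False using PQ(3) unfolding e_def dist_real_def by argo
qed

text \<open>Pairing with a fixed vector w commutes with both derivatives and reduces the claim to
  real-valued functions.\<close>

lemma pd_mixed:
  fixes f :: "real \<times> real \<Rightarrow> 'a::real_inner"
  assumes U: "open U" and f: "smooth_on U f" and p: "p \<in> U"
  shows "pd_v (pd_u f) p = pd_u (pd_v f) p"
proof -
  have "pd_v (pd_u f) p \<bullet> w = pd_u (pd_v f) p \<bullet> w" for w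
  proof -
    have d: "pd_u (\<lambda>x. g x \<bullet> w) q = pd_u g q \<bullet> w" "pd_v (\<lambda>x. g x \<bullet> w) q = pd_v g q \<bullet> w"
      if "q \<in> U" "smooth_on U g" for g :: "real \<times> real \<Rightarrow> 'a" and q
      using pd_bilinear[OF bounded_bilinear_inner smooth_on_imp_differentiable[OF U that(2,1)], of "\<lambda>_. w"]
      by auto
    have s: "smooth_on U (\<lambda>x. f x \<bullet> w)" by (intro smooth_on_intros U f)
    note diff = smooth_on_imp_differentiable[OF U _ p]
    have "pd_v (\<lambda>x. pd_u f x \<bullet> w) p = pd_v (pd_u (\<lambda>x. f x \<bullet> w)) p"
      unfolding pd_v_def
      using frechet_derivative_cong_open(2)[OF U p d(1)[OF _ f] diff[OF smooth_on_pd(1)[OF s]]] by simp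
    moreover have "pd_u (\<lambda>x. pd_v f x \<bullet> w) p = pd_u (pd_v (\<lambda>x. f x \<bullet> w)) p"
      unfolding pd_u_def
      using frechet_derivative_cong_open(2)[OF U p d(2)[OF _ f] diff[OF smooth_on_pd(2)[OF s]]] by simp
    ultimately show ?thesis
      using d[OF p smooth_on_pd(1)[OF f]] d[OF p smooth_on_pd(2)[OF f]] pd_mixed_real[OF U s p] by simp
  qed
  then show ?thesis using vector_eq_rdot by blast
qed

text \<open>The tangent field with coordinates \<open>(x1, x2)\<close> acting as a derivation on
  functions with values in any normed space. Applied to the immersion l it returns the field itself
  as a vector in R^4.\<close>

definition dd :: "(real \<times> real \<Rightarrow> real) \<Rightarrow> (real \<times> real \<Rightarrow> real) \<Rightarrow>
    (real \<times> real \<Rightarrow> 'a::real_normed_vector) \<Rightarrow> real \<times> real \<Rightarrow> 'a" where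
  "dd x1 x2 f p = x1 p *\<^sub>R pd_u f p + x2 p *\<^sub>R pd_v f p"

lemma dd_cong_open:
  assumes "open U" "p \<in> U" "f differentiable (at p)" "\<And>x. x \<in> U \<Longrightarrow> f x = g x"
  shows "dd x1 x2 f p = dd x1 x2 g p"
  using frechet_derivative_cong_open[of U p f g] assms by (simp add: dd_def pd_u_def pd_v_def)

lemma dd_const [simp]: "dd x1 x2 (\<lambda>_. c) = (\<lambda>_. 0)"
  by (auto simp: dd_def)

lemma dd_bilinear:
  assumes B: "bounded_bilinear B" and "f differentiable (at p)" "g differentiable (at p)"
  shows "dd x1 x2 (\<lambda>x. B (f x) (g x)) p = B (f p) (dd x1 x2 g p) + B (dd x1 x2 f p) (g p)"
  using pd_bilinear[OF assms]
  by (simp add: dd_def bounded_bilinear.add_left[OF B] bounded_bilinear.add_right[OF B]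
      bounded_bilinear.scaleR_left[OF B] bounded_bilinear.scaleR_right[OF B] scaleR_add_right)

lemmas dd_mult = dd_bilinear[OF bounded_bilinear_mult]
lemmas dd_inner = dd_bilinear[OF bounded_bilinear_inner]
lemmas dd_scaleR = dd_bilinear[OF bounded_bilinear_scaleR]

lemma dd_add:
  assumes "f differentiable (at p)" "g differentiable (at p)"
  shows "dd x1 x2 (\<lambda>x. f x + g x) p = dd x1 x2 f p + dd x1 x2 g p"
proof -
  have "((\<lambda>x. f x + g x) has_derivative
      (\<lambda>h. frechet_derivative f (at p) h + frechet_derivative g (at p) h)) (at p)"
    using assms by (auto intro!: has_derivative_add simp: frechet_derivative_works[symmetric])
  then show ?thesis
    by (auto simp: dd_def pd_u_def pd_v_def frechet_derivative_at[symmetric] algebra_simps)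
qed

lemma smooth_on_dd:
  "open U \<Longrightarrow> smooth_on U x1 \<Longrightarrow> smooth_on U x2 \<Longrightarrow> smooth_on U f \<Longrightarrow> smooth_on U (dd x1 x2 f)"
  unfolding dd_def[abs_def] by (intro smooth_on_intros)

text \<open>The second derivatives of f cancel because mixed partials agree; what remains is the Lie
  bracket, whose coordinates involve only the coefficient functions.\<close>

lemma dd_commutator:
  fixes f :: "real \<times> real \<Rightarrow> 'a::real_inner"
  assumes U: "open U" and p: "p \<in> U"
    and s: "smooth_on U f" "smooth_on U x1" "smooth_on U x2" "smooth_on U y1" "smooth_on U y2"
  shows "dd x1 x2 (dd y1 y2 f) p - dd y1 y2 (dd x1 x2 f) p =
    (dd x1 x2 y1 p - dd y1 y2 x1 p) *\<^sub>R pd_u f p + (dd x1 x2 y2 p - dd y1 y2 x2 p) *\<^sub>R pd_v f p"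
proof -
  note d = smooth_on_imp_differentiable[OF U _ p]
  have "dd a b (dd c e f) p = c p *\<^sub>R dd a b (pd_u f) p + dd a b c p *\<^sub>R pd_u f p +
      (e p *\<^sub>R dd a b (pd_v f) p + dd a b e p *\<^sub>R pd_v f p)"
    if "smooth_on U c" "smooth_on U e" for a b c e :: "real \<times> real \<Rightarrow> real"
    unfolding dd_def[of c e, abs_def]
    by (simp add: dd_add dd_scaleR d smooth_on_intros U s that)
  then show ?thesis
    using s pd_mixed[OF U s(1) p] by (simp add: dd_def[of _ _ "pd_u f"] dd_def[of _ _ "pd_v f"] algebra_simps)
qed

section \<open>Structure equations of an orthonormal frame\<close>

text \<open>Orthonormal vectors are independent, and four of them span by dimension.\<close>

lemma orthonormal_expansion_R4:
  fixes w :: "real^4"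
  assumes "v1 \<bullet> v1 = 1" "v2 \<bullet> v2 = 1" "v3 \<bullet> v3 = 1" "v4 \<bullet> v4 = 1"
    and "v1 \<bullet> v2 = 0" "v1 \<bullet> v3 = 0" "v1 \<bullet> v4 = 0" "v2 \<bullet> v3 = 0" "v2 \<bullet> v4 = 0" "v3 \<bullet> v4 = 0"
  shows "w = (w \<bullet> v1) *\<^sub>R v1 + (w \<bullet> v2) *\<^sub>R v2 + (w \<bullet> v3) *\<^sub>R v3 + (w \<bullet> v4) *\<^sub>R v4"
proof -
  let ?B = "{v1, v2, v3, v4}"
  have ne: "v1 \<noteq> v2" "v1 \<noteq> v3" "v1 \<noteq> v4" "v2 \<noteq> v3" "v2 \<noteq> v4" "v3 \<noteq> v4"
    using assms by auto
  have orth: "pairwise orthogonal ?B"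
    using assms by (auto simp: pairwise_def orthogonal_def inner_commute)
  have norm: "norm i = 1" if "i \<in> ?B" for i using that assms by (auto simp: norm_eq_1)
  then have "independent ?B" using pairwise_orthogonal_independent[OF orth] by force
  moreover have "card ?B = 4" using ne by simp
  ultimately have "UNIV \<subseteq> span ?B"
    by (intro card_ge_dim_independent) auto
  then have "(\<Sum>i\<in>?B. (w \<bullet> i) *\<^sub>R i) = w"
    by (intro orthonormal_basis_expand orth norm) auto
  then show ?thesis using ne by (simp add: add.assoc)
qed

text \<open>The Leibniz rule for an inner product of known value \<phi>: the derivative is moved
  from one factor to the other. Most frame computations below are instances.\<close>

lemma dd_inner_swap:
  assumes U: "open U" and p: "p \<in> U" and s: "smooth_on U f" "smooth_on U g"
    and eq: "\<And>q. q \<in> U \<Longrightarrow> f q \<bullet> g q = \<phi> q"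
  shows "dd x1 x2 f p \<bullet> g p = dd x1 x2 \<phi> p - f p \<bullet> dd x1 x2 g p"
proof -
  note d = smooth_on_imp_differentiable[OF U _ p]
  have "dd x1 x2 (\<lambda>q. f q \<bullet> g q) p = dd x1 x2 \<phi> p"
    by (rule dd_cong_open[OF U p]) (auto intro!: d smooth_on_intros U s eq)
  then show ?thesis using dd_inner[OF d d, OF s] by simp
qed

lemma dd_minus:
  assumes "f differentiable (at p)"
  shows "dd x1 x2 (\<lambda>x. - f x) p = - dd x1 x2 f p"
  using dd_scaleR[of "\<lambda>_. -1" p f x1 x2] assms by simp

text \<open>An orthonormal tangent frame \<open>X = x1 l\<^sub>u + x2 l\<^sub>v\<close>, \<open>Y = y1 l\<^sub>u + y2 l\<^sub>v\<close> of a minimal surface.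
  In the frame, \<open>a\<close> and \<open>b\<close> are the geodesic curvature functions and the second fundamental form
  has the matrix \<open>(h, k; k, -h)\<close>.\<close>

locale minimal_frame =
  fixes V :: "(real \<times> real) set" and l n :: "real \<times> real \<Rightarrow> real^4"
    and x1 x2 y1 y2 :: "real \<times> real \<Rightarrow> real"
  assumes V: "open V"
    and smooth: "smooth_on V l" "smooth_on V n" "smooth_on V x1" "smooth_on V x2"
      "smooth_on V y1" "smooth_on V y2"
    and indep: "\<And>p \<alpha> \<beta>. p \<in> V \<Longrightarrow> \<alpha> *\<^sub>R pd_u l p + \<beta> *\<^sub>R pd_v l p = 0 \<Longrightarrow> \<alpha> = 0 \<and> \<beta> = 0"
    and normal: "\<And>p. p \<in> V \<Longrightarrow> l p \<bullet> l p = 1" "\<And>p. p \<in> V \<Longrightarrow> n p \<bullet> n p = 1"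
      "\<And>p. p \<in> V \<Longrightarrow> n p \<bullet> l p = 0"
      "\<And>p. p \<in> V \<Longrightarrow> n p \<bullet> pd_u l p = 0" "\<And>p. p \<in> V \<Longrightarrow> n p \<bullet> pd_v l p = 0"
    and frame: "\<And>p. p \<in> V \<Longrightarrow> dd x1 x2 l p \<bullet> dd x1 x2 l p = 1"
      "\<And>p. p \<in> V \<Longrightarrow> dd y1 y2 l p \<bullet> dd y1 y2 l p = 1"
      "\<And>p. p \<in> V \<Longrightarrow> dd x1 x2 l p \<bullet> dd y1 y2 l p = 0"
    and traceless: "\<And>p. p \<in> V \<Longrightarrow> dd y1 y2 (dd y1 y2 l) p \<bullet> n p = - (dd x1 x2 (dd x1 x2 l) p \<bullet> n p)"
begin

abbreviation D1 :: "(real \<times> real \<Rightarrow> 'a::real_normed_vector) \<Rightarrow> real \<times> real \<Rightarrow> 'a" where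
  "D1 \<equiv> dd x1 x2"
abbreviation D2 :: "(real \<times> real \<Rightarrow> 'a::real_normed_vector) \<Rightarrow> real \<times> real \<Rightarrow> 'a" where
  "D2 \<equiv> dd y1 y2"

abbreviation "X \<equiv> D1 l"
abbreviation "Y \<equiv> D2 l"

definition "a p = D1 X p \<bullet> Y p"
definition "b p = D2 X p \<bullet> Y p"
definition "h p = D1 X p \<bullet> n p"
definition "k p = D1 Y p \<bullet> n p"

lemma smooth_D: "smooth_on V f \<Longrightarrow> smooth_on V (D1 f)" "smooth_on V f \<Longrightarrow> smooth_on V (D2 f)"
  by (intro smooth_on_dd V smooth; assumption)+

lemma smooth_coeffs: "smooth_on V a" "smooth_on V b" "smooth_on V h" "smooth_on V k"
  unfolding a_def[abs_def] b_def[abs_def] h_def[abs_def] k_def[abs_def]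
  by (intro smooth_on_inner V smooth_D smooth)+

lemma diff: "smooth_on V f \<Longrightarrow> p \<in> V \<Longrightarrow> f differentiable (at p)"
  using smooth_on_imp_differentiable V by blast

lemma orthonormal:
  assumes p: "p \<in> V"
  shows "X p \<bullet> X p = 1" "Y p \<bullet> Y p = 1" "X p \<bullet> Y p = 0" "Y p \<bullet> X p = 0"
    "l p \<bullet> l p = 1" "n p \<bullet> n p = 1" "n p \<bullet> l p = 0" "l p \<bullet> n p = 0"
    "X p \<bullet> n p = 0" "n p \<bullet> X p = 0" "Y p \<bullet> n p = 0" "n p \<bullet> Y p = 0"
    "X p \<bullet> l p = 0" "l p \<bullet> X p = 0" "Y p \<bullet> l p = 0" "l p \<bullet> Y p = 0"
proof -
  show "X p \<bullet> X p = 1" "Y p \<bullet> Y p = 1" "X p \<bullet> Y p = 0" "Y p \<bullet> X p = 0"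
    "l p \<bullet> l p = 1" "n p \<bullet> n p = 1" "n p \<bullet> l p = 0" "l p \<bullet> n p = 0"
    using frame normal p by (simp_all add: inner_commute)
  show "n p \<bullet> X p = 0" "n p \<bullet> Y p = 0"
    using normal p by (simp_all add: dd_def inner_add_right)
  then show "X p \<bullet> n p = 0" "Y p \<bullet> n p = 0" by (simp_all add: inner_commute)
  \<comment> \<open>Differentiating \<open>l p \<bullet> l p = 1\<close> yields a number equal to
    its own negative.\<close>
  show "X p \<bullet> l p = 0" "Y p \<bullet> l p = 0"
    using dd_inner_swap[OF V p smooth(1) smooth(1), of "\<lambda>_. 1"] normal(1) by (simp_all add: inner_commute)
  then show "l p \<bullet> X p = 0" "l p \<bullet> Y p = 0" by (simp_all add: inner_commute)
qed

lemma expansion: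
  assumes "p \<in> V"
  shows "w = (w \<bullet> X p) *\<^sub>R X p + (w \<bullet> Y p) *\<^sub>R Y p + (w \<bullet> n p) *\<^sub>R n p + (w \<bullet> l p) *\<^sub>R l p"
  by (rule orthonormal_expansion_R4) (use orthonormal[OF assms] in auto)

text \<open>Since X and Y are derivatives of l, the left side is the commutator of the two fields
  applied to l, that is, their Lie bracket as a tangent vector in R^4.\<close>

lemma bracket_X_Y:
  assumes p: "p \<in> V"
  shows "D1 Y p - D2 X p = (D1 y1 p - D2 x1 p) *\<^sub>R pd_u l p + (D1 y2 p - D2 x2 p) *\<^sub>R pd_v l p"
  by (rule dd_commutator[OF V p smooth(1,3,4,5,6)])

text \<open>Symmetry of the second fundamental form: the bracket of X and Y is tangent and so has no
  normal component.\<close>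

lemma D2_X_normal: "p \<in> V \<Longrightarrow> D2 X p \<bullet> n p = k p"
  using arg_cong[OF bracket_X_Y, of p "\<lambda>w. n p \<bullet> w"] normal(4,5)[of p]
  by (simp add: k_def inner_add_right inner_diff_right inner_commute[of _ "n p"])

text \<open>The Gauss and Weingarten formulas in the frame X, Y, n, l. All components come from
  differentiating orthonormality relations.\<close>

lemma structure_equations:
  assumes p: "p \<in> V"
  shows "D1 X p = a p *\<^sub>R Y p + h p *\<^sub>R n p - l p"
    and "D1 Y p = - a p *\<^sub>R X p + k p *\<^sub>R n p"
    and "D1 n p = - h p *\<^sub>R X p - k p *\<^sub>R Y p"
    and "D2 X p = b p *\<^sub>R Y p + k p *\<^sub>R n p"
    and "D2 Y p = - b p *\<^sub>R X p - h p *\<^sub>R n p - l p"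
    and "D2 n p = - k p *\<^sub>R X p + h p *\<^sub>R Y p"
proof -
  have sX: "smooth_on V X" and sY: "smooth_on V Y" by (intro smooth_D smooth)+
  \<comment> \<open>Each of these vectors has unit length, so its derivatives are orthogonal to
    it.\<close>
  have nn: "D1 n p \<bullet> n p = 0" "D2 n p \<bullet> n p = 0" "D1 X p \<bullet> X p = 0" "D2 X p \<bullet> X p = 0"
    "D1 Y p \<bullet> Y p = 0" "D2 Y p \<bullet> Y p = 0"
    using dd_inner_swap[OF V p, of n n "\<lambda>_. 1"] dd_inner_swap[OF V p, of X X "\<lambda>_. 1"]
      dd_inner_swap[OF V p, of Y Y "\<lambda>_. 1"] sX sY smooth(2) orthonormal(1,2,6)
    by (simp_all add: inner_commute)
  \<comment> \<open>Components along the position vector; the entries -1 are the curvature of the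
    sphere.\<close>
  have ll: "D1 X p \<bullet> l p = -1" "D1 Y p \<bullet> l p = 0" "D1 n p \<bullet> l p = 0"
    "D2 X p \<bullet> l p = 0" "D2 Y p \<bullet> l p = -1" "D2 n p \<bullet> l p = 0"
    using dd_inner_swap[OF V p, of X l "\<lambda>_. 0"] dd_inner_swap[OF V p, of Y l "\<lambda>_. 0"]
      dd_inner_swap[OF V p, of n l "\<lambda>_. 0"] sX sY smooth(1,2) orthonormal p by simp_all
  have YX: "D1 Y p \<bullet> X p = - a p" "D2 Y p \<bullet> X p = - b p"
    using dd_inner_swap[OF V p, of Y X "\<lambda>_. 0"] sX sY orthonormal(4)
    by (simp_all add: a_def b_def inner_commute)
  \<comment> \<open>The third entry uses the symmetry of the second fundamental form, the fourth its
    vanishing trace.\<close>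
  have n: "D1 n p \<bullet> X p = - h p" "D1 n p \<bullet> Y p = - k p" "D2 n p \<bullet> X p = - k p" "D2 n p \<bullet> Y p = h p"
    using dd_inner_swap[OF V p, of n X "\<lambda>_. 0"] dd_inner_swap[OF V p, of n Y "\<lambda>_. 0"]
      sX sY smooth(2) orthonormal(10,12) D2_X_normal[OF p] traceless[OF p]
    by (simp_all add: h_def k_def inner_commute[of "n p" "dd _ _ _ _"])
  have YN: "D2 Y p \<bullet> n p = - h p" using traceless[OF p] by (simp add: h_def)
  note e = expansion[OF p]
  show "D1 X p = a p *\<^sub>R Y p + h p *\<^sub>R n p - l p"
    by (subst e) (simp add: nn ll a_def h_def)
  show "D1 Y p = - a p *\<^sub>R X p + k p *\<^sub>R n p"
    by (subst e) (simp add: nn ll YX k_def)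
  show "D1 n p = - h p *\<^sub>R X p - k p *\<^sub>R Y p"
    by (subst e) (simp add: nn ll n)
  show "D2 X p = b p *\<^sub>R Y p + k p *\<^sub>R n p"
    by (subst e) (simp add: nn ll b_def D2_X_normal p)
  show "D2 Y p = - b p *\<^sub>R X p - h p *\<^sub>R n p - l p"
    by (subst e) (simp add: nn ll YX YN)
  show "D2 n p = - k p *\<^sub>R X p + h p *\<^sub>R Y p"
    by (subst e) (simp add: nn ll n)
qed

text \<open>The structure equations give \<open>- a p *\<^sub>R X p - b p *\<^sub>R Y p\<close> for
  the bracket applied to l. Independence of \<open>pd_u l\<close> and \<open>pd_v l\<close> turns
  this into equations for the bracket coordinates z1 and z2, which then hold for every f.\<close>

lemma D1_D2_commutator:
  fixes f :: "real \<times> real \<Rightarrow> 'a::real_inner"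
  assumes p: "p \<in> V" and f: "smooth_on V f"
  shows "D1 (D2 f) p - D2 (D1 f) p = - a p *\<^sub>R D1 f p - b p *\<^sub>R D2 f p"
proof -
  define z1 where "z1 = D1 y1 p - D2 x1 p"
  define z2 where "z2 = D1 y2 p - D2 x2 p"
  have "z1 *\<^sub>R pd_u l p + z2 *\<^sub>R pd_v l p = - a p *\<^sub>R X p - b p *\<^sub>R Y p"
    using bracket_X_Y[OF p] structure_equations[OF p] by (simp add: z1_def z2_def)
  moreover have "(z1 + a p * x1 p + b p * y1 p) *\<^sub>R pd_u l p + (z2 + a p * x2 p + b p * y2 p) *\<^sub>R pd_v l p
      = z1 *\<^sub>R pd_u l p + z2 *\<^sub>R pd_v l p - (- a p *\<^sub>R X p - b p *\<^sub>R Y p)"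
    by (simp add: dd_def algebra_simps)
  ultimately have "(z1 + a p * x1 p + b p * y1 p) *\<^sub>R pd_u l p +
      (z2 + a p * x2 p + b p * y2 p) *\<^sub>R pd_v l p = 0"
    by simp
  then have "z1 + a p * x1 p + b p * y1 p = 0" "z2 + a p * x2 p + b p * y2 p = 0"
    using indep[OF p] by blast+
  then have z: "z1 = - a p * x1 p - b p * y1 p" "z2 = - a p * x2 p - b p * y2 p" by simp_all
  have "D1 (D2 f) p - D2 (D1 f) p = z1 *\<^sub>R pd_u f p + z2 *\<^sub>R pd_v f p"
    unfolding z1_def z2_def by (rule dd_commutator[OF V p f smooth(3-6)])
  also have "\<dots> = - a p *\<^sub>R D1 f p - b p *\<^sub>R D2 f p"
    unfolding z dd_def by (simp add: algebra_simps)
  finally show ?thesis .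
qed

text \<open>The commutator applied to n gives the two Codazzi equations as its X and Y components;
  applied to X, its Y component is the Gauss equation, with Gauss curvature
  \<open>1 - (h p)\<^sup>2 - (k p)\<^sup>2\<close>.\<close>

lemma codazzi_gauss:
  assumes p: "p \<in> V"
  shows "D2 h p - D1 k p = 2 * a p * h p + 2 * b p * k p"
    and "D1 h p + D2 k p = 2 * a p * k p - 2 * b p * h p"
    and "D1 b p - D2 a p + (a p)\<^sup>2 + (b p)\<^sup>2 + 1 - (h p)\<^sup>2 - (k p)\<^sup>2 = 0"
proof -
  have sX: "smooth_on V X" and sY: "smooth_on V Y" by (intro smooth_D smooth)+
  have sn: "smooth_on V (D1 n)" "smooth_on V (D2 n)" "smooth_on V (D1 X)" "smooth_on V (D2 X)"
    by (intro smooth_D smooth)+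
  note st = structure_equations and on = orthonormal
  note s = inner_add_left inner_add_right inner_diff_left inner_diff_right
  have m: "dd u v (\<lambda>q. - k q) p = - dd u v k p" "dd u v (\<lambda>q. - h q) p = - dd u v h p" for u v
    by (intro dd_minus diff smooth_coeffs p)+
  have "D1 (D2 n) p \<bullet> X p = - D1 k p - a p * h p"
    using dd_inner_swap[OF V p sn(2) sX, of "\<lambda>q. - k q" x1 x2] by (simp add: st on s p m)
  moreover have "D2 (D1 n) p \<bullet> X p = - D2 h p + b p * k p"
    using dd_inner_swap[OF V p sn(1) sX, of "\<lambda>q. - h q" y1 y2] by (simp add: st on s p m)
  ultimately show "D2 h p - D1 k p = 2 * a p * h p + 2 * b p * k p"
    using arg_cong[OF D1_D2_commutator[OF p smooth(2)], of "\<lambda>w. w \<bullet> X p"] by (simp add: st on s p)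
  have "D1 (D2 n) p \<bullet> Y p = D1 h p - a p * k p"
    using dd_inner_swap[OF V p sn(2) sY, of h x1 x2] by (simp add: st on s p)
  moreover have "D2 (D1 n) p \<bullet> Y p = - D2 k p - b p * h p"
    using dd_inner_swap[OF V p sn(1) sY, of "\<lambda>q. - k q" y1 y2] by (simp add: st on s p m)
  ultimately show "D1 h p + D2 k p = 2 * a p * k p - 2 * b p * h p"
    using arg_cong[OF D1_D2_commutator[OF p smooth(2)], of "\<lambda>w. w \<bullet> Y p"]
    by (simp add: st on s p algebra_simps)
  have "D1 (D2 X) p \<bullet> Y p = D1 b p - (k p)\<^sup>2"
    using dd_inner_swap[OF V p sn(4) sY, of b x1 x2] by (simp add: st on s p power2_eq_square)
  moreover have "D2 (D1 X) p \<bullet> Y p = D2 a p + (h p)\<^sup>2 - 1"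
    using dd_inner_swap[OF V p sn(3) sY, of a y1 y2] by (simp add: st on s p power2_eq_square)
  ultimately show "D1 b p - D2 a p + (a p)\<^sup>2 + (b p)\<^sup>2 + 1 - (h p)\<^sup>2 - (k p)\<^sup>2 = 0"
    using arg_cong[OF D1_D2_commutator[OF p sX], of "\<lambda>w. w \<bullet> Y p"]
    by (simp add: st on s p power2_eq_square)
qed

end

section \<open>Circles on the surface\<close>

lemma frechet_derivative_eq_pd:
  assumes "f differentiable (at q)"
  shows "frechet_derivative f (at q) w = fst w *\<^sub>R pd_u f q + snd w *\<^sub>R pd_v f q"
proof -
  have lin: "linear (frechet_derivative f (at q))" using assms linear_frechet_derivative by blast
  have "frechet_derivative f (at q) w = frechet_derivative f (at q) (fst w *\<^sub>R (1, 0) + snd w *\<^sub>R (0, 1))"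
    by simp
  then show ?thesis
    unfolding pd_u_def pd_v_def linear_add[OF lin] linear_scale[OF lin] .
qed

lemma vd_eqI: "(f has_vector_derivative f') (at t) \<Longrightarrow> vd f t = f'"
  unfolding vd_def by (rule vector_derivative_at)

lemma has_vector_derivative_vd: "f differentiable (at t) \<Longrightarrow> (f has_vector_derivative vd f t) (at t)"
  unfolding vd_def by (simp add: vector_derivative_works)

context minimal_frame
begin

text \<open>For a unit-speed integral curve of X this vector is the third derivative of the curve in
  R^4; its components decide whether the curve is a circle.\<close>

lemma D1_D1_X_inner:
  assumes p: "p \<in> V"
  shows "D1 (D1 X) p \<bullet> l p = 0"
    and "D1 (D1 X) p \<bullet> Y p = D1 a p - h p * k p"
    and "D1 (D1 X) p \<bullet> n p = D1 h p + a p * k p"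
proof -
  have sX: "smooth_on V X" and sY: "smooth_on V Y" and sW: "smooth_on V (D1 X)"
    by (intro smooth_D smooth)+
  note st = structure_equations and on = orthonormal
  note s = inner_add_left inner_add_right inner_diff_left inner_diff_right
  show "D1 (D1 X) p \<bullet> l p = 0"
    using dd_inner_swap[OF V p sW smooth(1), of "\<lambda>_. -1" x1 x2] by (simp add: st on s p)
  show "D1 (D1 X) p \<bullet> Y p = D1 a p - h p * k p"
    using dd_inner_swap[OF V p sW sY, of a x1 x2] by (simp add: st on s p)
  show "D1 (D1 X) p \<bullet> n p = D1 h p + a p * k p"
    using dd_inner_swap[OF V p sW smooth(2), of h x1 x2] by (simp add: st on s p)
qed

text \<open>At unit speed the derivatives of the curve are X, \<open>D1 X\<close> and
  \<open>D1 (D1 X)\<close>, with l-components 0, -1 and 0. If the third vector lies in the span of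
  the other two, its coefficient along \<open>D1 X\<close> is therefore 0, so its Y and n components
  vanish. The proof carries the speed \<sigma> along, as the circle may have any regular
  parametrisation.\<close>

lemma circle_conditions:
  assumes I: "open I" "t0 \<in> I" and c: "\<And>t. t \<in> I \<Longrightarrow> c differentiable (at t)"
    and cV: "c ` I \<subseteq> V" and circle: "is_circle I (l \<circ> c)"
    and tangent: "\<And>t. t \<in> I \<Longrightarrow> (1 / norm (vd (l \<circ> c) t)) *\<^sub>R vd (l \<circ> c) t = X (c t)"
  shows "D1 a (c t0) = h (c t0) * k (c t0)" and "D1 h (c t0) = - a (c t0) * k (c t0)"
proof -
  define \<gamma> where "\<gamma> = l \<circ> c"
  define \<sigma> where "\<sigma> t = norm (vd \<gamma> t)" for t
  define W where "W = D1 X"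
  have inV: "c t \<in> V" if "t \<in> I" for t using cV that by blast
  have sX: "smooth_on V X" and sW: "smooth_on V W" unfolding W_def by (intro smooth_D smooth)+
  have reg: "vd \<gamma> differentiable (at t)" "vd (vd \<gamma>) differentiable (at t)" "\<sigma> t > 0" if "t \<in> I" for t
    using circle that unfolding is_circle_def \<gamma>_def[symmetric] \<sigma>_def by auto
  have vd1: "vd \<gamma> t = \<sigma> t *\<^sub>R X (c t)" if "t \<in> I" for t
    using reg(3)[OF that] unfolding tangent[OF that, folded \<gamma>_def, symmetric] \<sigma>_def[symmetric] by simp
  have chain0: "((\<lambda>t. f (c t)) has_vector_derivative
      (fst (vector_derivative c (at t)) *\<^sub>R pd_u f (c t) + snd (vector_derivative c (at t)) *\<^sub>R pd_v f (c t))) (at t)"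
    if "smooth_on V f" "t \<in> I" for f :: "real \<times> real \<Rightarrow> real^4" and t
  proof -
    have d: "f differentiable (at (c t))" using diff that inV by blast
    have "(c has_vector_derivative vector_derivative c (at t)) (at t)"
      using c[OF that(2)] by (simp add: vector_derivative_works)
    moreover have "(f has_derivative frechet_derivative f (at (c t))) (at (c t) within range c)"
      using d frechet_derivative_works has_derivative_at_withinI by blast
    ultimately show ?thesis
      using vector_derivative_diff_chain_within[of c "vector_derivative c (at t)" t UNIV f
          "frechet_derivative f (at (c t))"]
      unfolding frechet_derivative_eq_pd[OF d] o_def by blast
  qed
  \<comment> \<open>Independence of \<open>pd_u l\<close> and \<open>pd_v l\<close> lifts the
    tangency condition from R^4 to the parameter plane.\<close>
  have velocity: "fst (vector_derivative c (at t)) = \<sigma> t * x1 (c t)"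
    "snd (vector_derivative c (at t)) = \<sigma> t * x2 (c t)" if "t \<in> I" for t
  proof -
    have "fst (vector_derivative c (at t)) *\<^sub>R pd_u l (c t) + snd (vector_derivative c (at t)) *\<^sub>R pd_v l (c t)
        = \<sigma> t *\<^sub>R X (c t)"
      using vd_eqI[OF chain0[OF smooth(1) that]] vd1[OF that] by (simp add: \<gamma>_def o_def)
    then have "(fst (vector_derivative c (at t)) - \<sigma> t * x1 (c t)) *\<^sub>R pd_u l (c t) +
        (snd (vector_derivative c (at t)) - \<sigma> t * x2 (c t)) *\<^sub>R pd_v l (c t) = 0"
      by (simp add: dd_def algebra_simps)
    from indep[OF inV[OF that] this] show "fst (vector_derivative c (at t)) = \<sigma> t * x1 (c t)"
      "snd (vector_derivative c (at t)) = \<sigma> t * x2 (c t)" by simp_all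
  qed
  have chain: "((\<lambda>t. f (c t)) has_vector_derivative \<sigma> t *\<^sub>R D1 f (c t)) (at t)"
    if "smooth_on V f" "t \<in> I" for f :: "real \<times> real \<Rightarrow> real^4" and t
    using chain0[OF that] unfolding velocity[OF that(2)] dd_def by (simp add: algebra_simps)
  \<comment> \<open>W is never zero because of its l-component -1: no curve in the sphere is
    straight.\<close>
  have W: "W q \<bullet> X q = 0" "X q \<bullet> W q = 0" "W q \<bullet> l q = -1" "W q \<bullet> Y q = a q" "W q \<bullet> n q = h q" "W q \<bullet> W q > 0"
    if "q \<in> V" for q
  proof -
    show "W q \<bullet> X q = 0" "W q \<bullet> l q = -1" "W q \<bullet> Y q = a q" "W q \<bullet> n q = h q"
      by (simp_all add: W_def structure_equations orthonormal that inner_add_left inner_diff_left)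
    then show "X q \<bullet> W q = 0" "W q \<bullet> W q > 0" by (auto simp: inner_commute)
  qed
  \<comment> \<open>The derivative of the speed, read off from
    \<open>\<sigma> t = vd \<gamma> t \<bullet> X (c t)\<close> since X is orthogonal to W. This
    form can be differentiated once more by the regularity in \<open>is_circle\<close>.\<close>
  define \<sigma>1 where "\<sigma>1 t = vd (vd \<gamma>) t \<bullet> X (c t)" for t
  have d\<sigma>: "(\<sigma> has_vector_derivative \<sigma>1 t) (at t)" if "t \<in> I" for t
  proof -
    have "((\<lambda>t. vd \<gamma> t \<bullet> X (c t)) has_vector_derivative
        (vd \<gamma> t \<bullet> (\<sigma> t *\<^sub>R D1 X (c t)) + vd (vd \<gamma>) t \<bullet> X (c t))) (at t)"
      by (intro bounded_bilinear.has_vector_derivative[OF bounded_bilinear_inner]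
          has_vector_derivative_vd reg chain sX that)
    moreover have "vd \<gamma> t \<bullet> (\<sigma> t *\<^sub>R D1 X (c t)) = 0"
      using W(2)[OF inV[OF that]] by (simp add: vd1[OF that] W_def)
    ultimately have "((\<lambda>t. vd \<gamma> t \<bullet> X (c t)) has_vector_derivative \<sigma>1 t) (at t)"
      unfolding \<sigma>1_def by (simp only: add_0_left)
    then show ?thesis
      by (rule has_vector_derivative_transform_within_open[OF _ I(1) that])
        (simp add: vd1 orthonormal inV)
  qed
  have vd2: "vd (vd \<gamma>) t = (\<sigma> t * \<sigma> t) *\<^sub>R W (c t) + \<sigma>1 t *\<^sub>R X (c t)" if "t \<in> I" for t
  proof (rule vd_eqI)
    have "((\<lambda>t. \<sigma> t *\<^sub>R X (c t)) has_vector_derivative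
        (\<sigma> t *\<^sub>R (\<sigma> t *\<^sub>R D1 X (c t)) + \<sigma>1 t *\<^sub>R X (c t))) (at t)"
      by (intro bounded_bilinear.has_vector_derivative[OF bounded_bilinear_scaleR] d\<sigma> chain sX that)
    then have "(vd \<gamma> has_vector_derivative (\<sigma> t *\<^sub>R (\<sigma> t *\<^sub>R D1 X (c t)) + \<sigma>1 t *\<^sub>R X (c t))) (at t)"
      by (rule has_vector_derivative_transform_within_open[OF _ I(1) that]) (simp add: vd1)
    then show "(vd \<gamma> has_vector_derivative (\<sigma> t * \<sigma> t) *\<^sub>R W (c t) + \<sigma>1 t *\<^sub>R X (c t)) (at t)"
      by (simp add: W_def)
  qed
  define \<sigma>2 where "\<sigma>2 = vd (vd \<gamma>) t0 \<bullet> (\<sigma> t0 *\<^sub>R D1 X (c t0)) + vd (vd (vd \<gamma>)) t0 \<bullet> X (c t0)"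
  have d\<sigma>1: "(\<sigma>1 has_vector_derivative \<sigma>2) (at t0)"
    unfolding \<sigma>1_def[abs_def] \<sigma>2_def
    by (intro bounded_bilinear.has_vector_derivative[OF bounded_bilinear_inner]
        has_vector_derivative_vd reg chain sX I(2))
  let ?q = "c t0"
  have q: "?q \<in> V" and pos: "\<sigma> t0 > 0" using inV reg I by auto
  have vd3: "vd (vd (vd \<gamma>)) t0 = (\<sigma> t0 ^ 3) *\<^sub>R D1 W ?q + (3 * \<sigma> t0 * \<sigma>1 t0) *\<^sub>R W ?q + \<sigma>2 *\<^sub>R X ?q"
  proof (rule vd_eqI)
    have "((\<lambda>t. (\<sigma> t * \<sigma> t) *\<^sub>R W (c t) + \<sigma>1 t *\<^sub>R X (c t)) has_vector_derivative
        ((\<sigma> t0 * \<sigma> t0) *\<^sub>R (\<sigma> t0 *\<^sub>R D1 W ?q) + (\<sigma> t0 * \<sigma>1 t0 + \<sigma>1 t0 * \<sigma> t0) *\<^sub>R W ?q +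
         (\<sigma>1 t0 *\<^sub>R (\<sigma> t0 *\<^sub>R D1 X ?q) + \<sigma>2 *\<^sub>R X ?q))) (at t0)"
      by (intro has_vector_derivative_add bounded_bilinear.has_vector_derivative[OF bounded_bilinear_scaleR]
          bounded_bilinear.has_vector_derivative[OF bounded_bilinear_mult] d\<sigma> d\<sigma>1 chain sX sW I(2))
    then have "(vd (vd \<gamma>) has_vector_derivative
        ((\<sigma> t0 * \<sigma> t0) *\<^sub>R (\<sigma> t0 *\<^sub>R D1 W ?q) + (\<sigma> t0 * \<sigma>1 t0 + \<sigma>1 t0 * \<sigma> t0) *\<^sub>R W ?q +
         (\<sigma>1 t0 *\<^sub>R (\<sigma> t0 *\<^sub>R D1 X ?q) + \<sigma>2 *\<^sub>R X ?q))) (at t0)"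
      by (rule has_vector_derivative_transform_within_open[OF _ I]) (simp add: vd2)
    then show "(vd (vd \<gamma>) has_vector_derivative
        (\<sigma> t0 ^ 3) *\<^sub>R D1 W ?q + (3 * \<sigma> t0 * \<sigma>1 t0) *\<^sub>R W ?q + \<sigma>2 *\<^sub>R X ?q) (at t0)"
      unfolding W_def[symmetric] by (rule back_subst[where P = "\<lambda>w. (_ has_vector_derivative w) _"])
        (simp add: scaleR_scaleR scaleR_left_distrib[symmetric] power3_eq_cube algebra_simps)
  qed
  \<comment> \<open>The first curvature is the length of W, hence nonzero, so the span condition of
    \<open>is_circle\<close> applies.\<close>
  have "frenet_kappa1 \<gamma> t0 \<noteq> 0"
  proof -
    have "(norm (vd \<gamma> t0))\<^sup>2 * (norm (vd (vd \<gamma>) t0))\<^sup>2 - (vd \<gamma> t0 \<bullet> vd (vd \<gamma>) t0)\<^sup>2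
        = \<sigma> t0 ^ 6 * (W ?q \<bullet> W ?q)"
      unfolding power2_norm_eq_inner vd1[OF I(2)] vd2[OF I(2)]
      by (simp add: inner_add_left inner_add_right W orthonormal q) algebra
    then show ?thesis
      using pos W(6)[OF q] unfolding frenet_kappa1_def by (simp add: \<sigma>_def)
  qed
  then have "vd (vd (vd \<gamma>)) t0 \<in> span {vd \<gamma> t0, vd (vd \<gamma>) t0}"
    using circle I unfolding is_circle_def \<gamma>_def[symmetric] by blast
  then obtain \<alpha> \<beta> where "vd (vd (vd \<gamma>)) t0 = \<alpha> *\<^sub>R vd \<gamma> t0 + \<beta> *\<^sub>R vd (vd \<gamma>) t0"
    by (auto simp: span_breakdown_eq algebra_simps)
  then have eq: "(\<sigma> t0 ^ 3) * (D1 W ?q \<bullet> w) + (3 * \<sigma> t0 * \<sigma>1 t0) * (W ?q \<bullet> w) + \<sigma>2 * (X ?q \<bullet> w)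
      = \<alpha> * (\<sigma> t0 * (X ?q \<bullet> w)) + \<beta> * ((\<sigma> t0 * \<sigma> t0) * (W ?q \<bullet> w) + \<sigma>1 t0 * (X ?q \<bullet> w))" for w
    unfolding vd3 vd2[OF I(2)] vd1[OF I(2)]
    by (drule_tac arg_cong[of _ _ "\<lambda>v. v \<bullet> w"]) (simp add: inner_add_left)
  note DW = D1_D1_X_inner[OF q, folded W_def]
  \<comment> \<open>The l-component fixes \<beta>, after which all W-terms cancel in the Y and n
    components.\<close>
  have \<beta>: "3 * \<sigma> t0 * \<sigma>1 t0 = \<beta> * (\<sigma> t0 * \<sigma> t0)"
    using eq[of "l ?q"] by (simp add: DW W q orthonormal)
  have "D1 W ?q \<bullet> Y ?q = 0" "D1 W ?q \<bullet> n ?q = 0"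
    using eq[of "Y ?q"] eq[of "n ?q"] pos by (simp_all add: \<beta> q orthonormal)
  then show "D1 a ?q = h ?q * k ?q" "D1 h ?q = - a ?q * k ?q"
    by (simp_all add: DW)
qed

section \<open>Circles at a constant angle to the principal lines\<close>

lemma dd_cmult:
  fixes f g :: "real \<times> real \<Rightarrow> real"
  assumes "p \<in> V" "smooth_on V f" "\<And>q. q \<in> V \<Longrightarrow> g q = r * f q"
  shows "dd u v g p = r * dd u v f p"
proof -
  have "dd u v (\<lambda>q. r * f q) p = dd u v g p"
    by (rule dd_cong_open[OF V assms(1) diff[OF smooth_on_mult[OF V smooth_on_const assms(2)] assms(1)]])
      (simp add: assms(3))
  then show ?thesis using dd_mult[of "\<lambda>_. r" p f u v] diff[OF assms(2,1)] by simp
qed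

text \<open>Here c and s stand for cos 2\<theta> and sin 2\<theta>, and \<mu> for the nonzero
  principal curvature; the formulas for h and k are its second fundamental form in the rotated
  frame.\<close>

lemma circle_angle_rigidity:
  assumes ne: "V \<noteq> {}" and cs: "c\<^sup>2 + s\<^sup>2 = 1"
    and \<mu>: "smooth_on V \<mu>" "\<And>p. p \<in> V \<Longrightarrow> \<mu> p \<noteq> 0"
    and hk: "\<And>p. p \<in> V \<Longrightarrow> h p = c * \<mu> p" "\<And>p. p \<in> V \<Longrightarrow> k p = - s * \<mu> p"
    and circ: "\<And>p. p \<in> V \<Longrightarrow> D1 a p = h p * k p" "\<And>p. p \<in> V \<Longrightarrow> D1 h p = - a p * k p"
  shows "s = 0 \<or> c = 0"
proof (rule ccontr)
  assume "\<not> (s = 0 \<or> c = 0)"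
  then have s: "s \<noteq> 0" and c: "c \<noteq> 0" by auto
  \<comment> \<open>The constant ratio a/b, found by inserting
    \<open>D1 \<mu> p = - 2 * b p * \<mu> p\<close> into the second circle condition.\<close>
  define m where "m = - 2 * c / s"
  have ms: "m * s = - 2 * c" using s by (simp add: m_def)
  have dh: "dd u v h p = c * dd u v \<mu> p" "dd u v k p = - s * dd u v \<mu> p" if "p \<in> V" for u v p
    using dd_cmult[OF that \<mu>(1)] hk by blast+
  have d\<mu>: "D2 \<mu> p = 2 * a p * \<mu> p" "D1 \<mu> p = - 2 * b p * \<mu> p" if p: "p \<in> V" for p
  proof -
    \<comment> \<open>The Codazzi equations are a linear system for \<open>D1 \<mu>\<close> and
      \<open>D2 \<mu>\<close> with orthogonal matrix; the combinations below invert it.\<close>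
    have 1: "c * D2 \<mu> p + s * D1 \<mu> p = 2 * a p * (c * \<mu> p) - 2 * b p * (s * \<mu> p)"
      using codazzi_gauss(1)[OF p] by (simp add: dh[OF p] hk[OF p])
    have 2: "c * D1 \<mu> p - s * D2 \<mu> p = - 2 * a p * (s * \<mu> p) - 2 * b p * (c * \<mu> p)"
      using codazzi_gauss(2)[OF p] by (simp add: dh[OF p] hk[OF p])
    have "(c\<^sup>2 + s\<^sup>2) * D2 \<mu> p = (c\<^sup>2 + s\<^sup>2) * (2 * a p * \<mu> p)"
      using 1 2 by algebra
    then show "D2 \<mu> p = 2 * a p * \<mu> p" by (simp add: cs)
    have "(c\<^sup>2 + s\<^sup>2) * D1 \<mu> p = (c\<^sup>2 + s\<^sup>2) * (- 2 * b p * \<mu> p)"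
      using 1 2 by algebra
    then show "D1 \<mu> p = - 2 * b p * \<mu> p" by (simp add: cs)
  qed
  have ab: "a p = m * b p" if p: "p \<in> V" for p
  proof -
    have "c * (- 2 * b p * \<mu> p) = a p * s * \<mu> p"
      using circ(2)[OF p] by (simp add: dh[OF p] d\<mu>[OF p] hk[OF p])
    then have "s * a p = s * (m * b p)" using \<mu>(2)[OF p] ms by algebra
    then show ?thesis using s by simp
  qed
  have da: "dd u v a p = m * dd u v b p" if "p \<in> V" for u v p
    using dd_cmult[OF that smooth_coeffs(2)] ab by blast
  have D1b: "2 * D1 b p = s\<^sup>2 * (\<mu> p)\<^sup>2" if p: "p \<in> V" for p
  proof -
    have "m * D1 b p = - c * s * (\<mu> p)\<^sup>2"
      using circ(1)[OF p] by (simp add: da[OF p] hk[OF p] power2_eq_square)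
    then have "c * (2 * D1 b p) = c * (s\<^sup>2 * (\<mu> p)\<^sup>2)" using ms by algebra
    then show ?thesis using c by simp
  qed
  have D2b: "D2 b p = c * s * (\<mu> p)\<^sup>2" if p: "p \<in> V" for p
  proof -
    have der: "dd u v (\<lambda>q. r * f q * \<mu> q) p = r * (f p * dd u v \<mu> p + dd u v f p * \<mu> p)"
      if "smooth_on V f" for r u v and f :: "real \<times> real \<Rightarrow> real"
      using dd_cmult[OF p smooth_on_mult[OF V that \<mu>(1)], of "\<lambda>q. r * f q * \<mu> q" r u v]
        dd_mult[OF diff[OF that p] diff[OF \<mu>(1) p], of u v] by (simp add: mult.assoc)
    have "D1 (D2 \<mu>) p = D1 (\<lambda>q. 2 * a q * \<mu> q) p" "D2 (D1 \<mu>) p = D2 (\<lambda>q. (-2) * b q * \<mu> q) p"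
      by (rule dd_cong_open[OF V p]; simp add: diff smooth_D \<mu>(1) p d\<mu>)+
    then have "D1 (D2 \<mu>) p = 2 * (a p * D1 \<mu> p + D1 a p * \<mu> p)"
      "D2 (D1 \<mu>) p = - 2 * (b p * D2 \<mu> p + D2 b p * \<mu> p)"
      by (simp_all only: der[OF smooth_coeffs(1)] der[OF smooth_coeffs(2)])
    \<comment> \<open>Both sides of the bracket identity produce terms in
      \<open>a p * b p * \<mu> p\<close>, which cancel, leaving only the derivatives of a and
      b.\<close>
    with D1_D2_commutator[OF p \<mu>(1)] have "(D1 a p + D2 b p) * \<mu> p = 0"
      by (simp add: d\<mu>[OF p]) algebra
    then have "D2 b p = - D1 a p" using \<mu>(2)[OF p] by simp
    then show ?thesis by (simp add: circ(1)[OF p] hk[OF p] power2_eq_square)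
  qed
  \<comment> \<open>A and B are the coefficients that arise when the Gauss equation is multiplied by
    s^2 and the values of m, \<open>D1 b\<close> and \<open>D2 b\<close> are inserted.\<close>
  define A where "A = s\<^sup>2 + 4 * c\<^sup>2"
  define B where "B = s\<^sup>2 * (1 - s\<^sup>2 / 2 - 2 * c\<^sup>2)"
  have gauss: "A * (b p)\<^sup>2 = B * (\<mu> p)\<^sup>2 - s\<^sup>2" if p: "p \<in> V" for p
  proof -
    have "D1 b p - m * D2 b p + m\<^sup>2 * (b p)\<^sup>2 + (b p)\<^sup>2 + 1 - (c\<^sup>2 + s\<^sup>2) * (\<mu> p)\<^sup>2 = 0"
      using codazzi_gauss(3)[OF p] by (simp add: da[OF p] ab[OF p] hk[OF p] power2_eq_square algebra_simps)
    then have "s\<^sup>2 * (D1 b p - m * D2 b p + m\<^sup>2 * (b p)\<^sup>2 + (b p)\<^sup>2 + 1 - (\<mu> p)\<^sup>2) = 0"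
      by (simp add: cs)
    then show ?thesis
      using D1b[OF p] D2b[OF p] ms unfolding A_def B_def by algebra
  qed
  \<comment> \<open>Differentiating the relation \<open>gauss\<close> along X makes every term a
    multiple of b \<mu>^2.\<close>
  have b0: "b p = 0" if p: "p \<in> V" for p
  proof -
    have "D1 (\<lambda>q. A * (b q * b q) + s\<^sup>2) p = D1 (\<lambda>q. B * (\<mu> q * \<mu> q)) p"
      by (rule dd_cong_open[OF V p])
        (use gauss in \<open>auto intro!: diff p smooth_on_intros V smooth_coeffs \<mu>(1) simp: power2_eq_square\<close>)
    moreover have "D1 (\<lambda>q. A * (b q * b q) + s\<^sup>2) p = A * (2 * b p * D1 b p)"
      by (simp add: dd_add dd_mult diff p smooth_on_intros V smooth_coeffs)
    moreover have "D1 (\<lambda>q. B * (\<mu> q * \<mu> q)) p = B * (2 * \<mu> p * D1 \<mu> p)"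
      by (simp add: dd_mult diff p smooth_on_intros V \<mu>(1))
    ultimately have "A * (b p * (s\<^sup>2 * (\<mu> p)\<^sup>2)) = - 4 * B * b p * (\<mu> p)\<^sup>2"
      using D1b[OF p] d\<mu>(2)[OF p] by algebra
    then have "(s\<^sup>2 * (\<mu> p)\<^sup>2) * b p * (A + 4 * (1 - s\<^sup>2 / 2 - 2 * c\<^sup>2)) = 0"
      unfolding B_def by algebra
    \<comment> \<open>By c^2 + s^2 = 1 the remaining factor is 3 s^2, which is nonzero.\<close>
    moreover have "A + 4 * (1 - s\<^sup>2 / 2 - 2 * c\<^sup>2) = 3 * s\<^sup>2"
      using cs unfolding A_def by algebra
    ultimately have "(s\<^sup>2 * (\<mu> p)\<^sup>2) * b p * (3 * s\<^sup>2) = 0" by (simp only:)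
    then show ?thesis using s \<mu>(2)[OF p] by simp
  qed
  from ne obtain p where p: "p \<in> V" by blast
  \<comment> \<open>On V the function b equals 0 times itself, so its derivative is 0 as well; this
    contradicts \<open>D1b\<close>.\<close>
  have "D1 b p = 0" using dd_cmult[OF p smooth_coeffs(2), of b 0 x1 x2] b0 by simp
  then show False using D1b[OF p] s \<mu>(2)[OF p] by simp
qed

end

section \<open>Smoothness of the principal frame\<close>

text \<open>The second fundamental form as a bilinear form; the arguments are the coordinates of two
  tangent vectors in the basis \<open>pd_u l\<close>, \<open>pd_v l\<close>.\<close>

definition sff :: "(real \<times> real \<Rightarrow> real^4) \<Rightarrow> (real \<times> real \<Rightarrow> real^4) \<Rightarrow> real \<times> real \<Rightarrow>
    real \<Rightarrow> real \<Rightarrow> real \<Rightarrow> real \<Rightarrow> real" where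
  "sff l n p \<alpha> \<beta> \<gamma> \<delta> = \<alpha> * \<gamma> * sL l n p + (\<alpha> * \<delta> + \<beta> * \<gamma>) * sM l n p + \<beta> * \<delta> * sN l n p"

lemma sff_bilinear:
  "sff l n p (c * \<alpha> + s * \<gamma>) (c * \<beta> + s * \<delta>) (c' * \<alpha> + s' * \<gamma>) (c' * \<beta> + s' * \<delta>) =
    c * c' * sff l n p \<alpha> \<beta> \<alpha> \<beta> + (c * s' + s * c') * sff l n p \<alpha> \<beta> \<gamma> \<delta> + s * s' * sff l n p \<gamma> \<delta> \<gamma> \<delta>"
  by (simp add: sff_def algebra_simps)

text \<open>Terms with a differentiated coefficient y1 or y2 are tangent and drop out against n, so
  the second derivative enters only through sL, sM, sN.\<close>

lemma dd_dd_inner_normal: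
  assumes U: "open U" and p: "p \<in> U" and s: "smooth_on U l" "smooth_on U y1" "smooth_on U y2"
    and n: "n p \<bullet> pd_u l p = 0" "n p \<bullet> pd_v l p = 0"
  shows "dd x1 x2 (dd y1 y2 l) p \<bullet> n p = sff l n p (x1 p) (x2 p) (y1 p) (y2 p)"
proof -
  note d = smooth_on_imp_differentiable[OF U _ p]
  have "dd x1 x2 (dd y1 y2 l) p =
      y1 p *\<^sub>R dd x1 x2 (pd_u l) p + dd x1 x2 y1 p *\<^sub>R pd_u l p +
      (y2 p *\<^sub>R dd x1 x2 (pd_v l) p + dd x1 x2 y2 p *\<^sub>R pd_v l p)"
    unfolding dd_def[of y1 y2, abs_def] by (simp add: dd_add dd_scaleR d smooth_on_intros U s)
  then have "dd x1 x2 (dd y1 y2 l) p \<bullet> n p =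
      y1 p * (dd x1 x2 (pd_u l) p \<bullet> n p) + y2 p * (dd x1 x2 (pd_v l) p \<bullet> n p)"
    using n by (simp add: inner_add_left inner_commute[of _ "n p"] inner_add_right)
  then show ?thesis
    using pd_mixed[OF U s(1) p]
    by (simp add: dd_def[of x1 x2] sff_def sL_def sM_def sN_def inner_add_left algebra_simps)
qed

text \<open>The entries of \<open>e e\<^sup>T\<close> for a unit eigenvector \<open>e = (\<alpha>, \<beta>)\<close> with eigenvalue \<open>r\<close>
  are rational in \<open>r\<close> and the coefficients of the two forms, so a continuous \<open>e\<close> is as smooth as these.\<close>

lemma traceless_eigenvector:
  fixes E F G L M N r \<alpha> \<beta> :: real
  assumes unit: "E * \<alpha>\<^sup>2 + 2 * F * \<alpha> * \<beta> + G * \<beta>\<^sup>2 = 1"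
    and eig: "L * \<alpha> + M * \<beta> = r * (E * \<alpha> + F * \<beta>)" "M * \<alpha> + N * \<beta> = r * (F * \<alpha> + G * \<beta>)"
    and trace: "E * N - 2 * F * M + G * L = 0"
  shows "r\<^sup>2 * (E * G - F\<^sup>2) = M\<^sup>2 - L * N"
    and "2 * r * (E * G - F\<^sup>2) * \<alpha>\<^sup>2 = r * G - N"
    and "2 * r * (E * G - F\<^sup>2) * \<beta>\<^sup>2 = r * E - L"
    and "2 * r * (E * G - F\<^sup>2) * (\<alpha> * \<beta>) = M - r * F"
  using assms by algebra+

text \<open>In a plane the second unit vector is the first one rotated by a right angle, up to the
  sign of t. Only t has to be found, and its square is the reciprocal of the metric
  determinant.\<close>

lemma traceless_eigenvector_orthogonal:
  fixes E F G L M N r \<alpha> \<beta> \<gamma> \<delta> :: real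
  assumes unit: "E * \<alpha>\<^sup>2 + 2 * F * \<alpha> * \<beta> + G * \<beta>\<^sup>2 = 1" "E * \<gamma>\<^sup>2 + 2 * F * \<gamma> * \<delta> + G * \<delta>\<^sup>2 = 1"
    and orth: "E * \<alpha> * \<gamma> + F * (\<alpha> * \<delta> + \<beta> * \<gamma>) + G * \<beta> * \<delta> = 0"
    and eig: "L * \<alpha> + M * \<beta> = r * (E * \<alpha> + F * \<beta>)" "M * \<alpha> + N * \<beta> = r * (F * \<alpha> + G * \<beta>)"
    and trace: "E * N - 2 * F * M + G * L = 0"
  defines "t \<equiv> \<alpha> * \<delta> - \<beta> * \<gamma>"
  shows "\<gamma> = - t * (F * \<alpha> + G * \<beta>)" "\<delta> = t * (E * \<alpha> + F * \<beta>)" "t\<^sup>2 * (E * G - F\<^sup>2) = 1"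
    and "\<alpha> * \<gamma> * L + (\<alpha> * \<delta> + \<beta> * \<gamma>) * M + \<beta> * \<delta> * N = 0"
    and "\<gamma> * \<gamma> * L + (\<gamma> * \<delta> + \<delta> * \<gamma>) * M + \<delta> * \<delta> * N = - r"
proof -
  show g: "\<gamma> = - t * (F * \<alpha> + G * \<beta>)" and d: "\<delta> = t * (E * \<alpha> + F * \<beta>)"
    using unit(1) orth unfolding t_def by algebra+
  have "E * \<gamma>\<^sup>2 + 2 * F * \<gamma> * \<delta> + G * \<delta>\<^sup>2
      = t\<^sup>2 * (E * G - F\<^sup>2) * (E * \<alpha>\<^sup>2 + 2 * F * \<alpha> * \<beta> + G * \<beta>\<^sup>2)"
    unfolding g d by algebra
  then show t: "t\<^sup>2 * (E * G - F\<^sup>2) = 1" using unit by simp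
  show "\<alpha> * \<gamma> * L + (\<alpha> * \<delta> + \<beta> * \<gamma>) * M + \<beta> * \<delta> * N = 0"
    using orth eig by algebra
  \<comment> \<open>Together 1 and 2 say that the rotated vector is an eigenvector for -r; this is
    where the vanishing trace enters.\<close>
  have 1: "L * (F * \<alpha> + G * \<beta>) - M * (E * \<alpha> + F * \<beta>) = - r * (E * G - F\<^sup>2) * \<beta>"
    using eig trace by algebra
  have 2: "N * (E * \<alpha> + F * \<beta>) - M * (F * \<alpha> + G * \<beta>) = - r * (E * G - F\<^sup>2) * \<alpha>"
    using eig trace by algebra
  have "\<gamma> * \<gamma> * L + (\<gamma> * \<delta> + \<delta> * \<gamma>) * M + \<delta> * \<delta> * N =
      t\<^sup>2 * ((F * \<alpha> + G * \<beta>) * (L * (F * \<alpha> + G * \<beta>) - M * (E * \<alpha> + F * \<beta>)) +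
        (E * \<alpha> + F * \<beta>) * (N * (E * \<alpha> + F * \<beta>) - M * (F * \<alpha> + G * \<beta>)))"
    unfolding g d by algebra
  also have "\<dots> = - r * (t\<^sup>2 * (E * G - F\<^sup>2)) * (E * \<alpha>\<^sup>2 + 2 * F * \<alpha> * \<beta> + G * \<beta>\<^sup>2)"
    unfolding 1 2 by algebra
  finally show "\<gamma> * \<gamma> * L + (\<gamma> * \<delta> + \<delta> * \<gamma>) * M + \<delta> * \<delta> * N = - r"
    using t unit by simp
qed

section \<open>Coordinates in the tangent plane\<close>

lemma independent_pairD:
  assumes "independent {v, w}" "v \<noteq> w" "\<alpha> *\<^sub>R v + \<beta> *\<^sub>R w = (0::'a::real_vector)"
  shows "\<alpha> = 0 \<and> \<beta> = 0"
proof -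
  have "(\<Sum>x\<in>{v, w}. (if x = v then \<alpha> else \<beta>) *\<^sub>R x) = 0"
    using assms(2,3) by simp
  then have "(if x = v then \<alpha> else \<beta>) = 0" if "x \<in> {v, w}" for x
    using independentD[OF assms(1), of "{v, w}" "\<lambda>x. if x = v then \<alpha> else \<beta>"] that by blast
  then show ?thesis using assms(2) by (metis insert_iff)
qed

lemma gram_pos:
  fixes v w :: "'a::real_inner"
  assumes "independent {v, w}" "v \<noteq> w"
  shows "v \<bullet> v > 0" "(v \<bullet> v) * (w \<bullet> w) - (v \<bullet> w)\<^sup>2 > 0"
proof -
  have "v \<noteq> 0" using assms(1) dependent_zero by blast
  then show E: "v \<bullet> v > 0" by simp
  \<comment> \<open>A multiple of the component of w orthogonal to v; its squared length contains
    the Gram determinant as a factor.\<close>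
  let ?z = "(- (v \<bullet> w)) *\<^sub>R v + (v \<bullet> v) *\<^sub>R w"
  have "?z \<noteq> 0" using independent_pairD[OF assms, of "- (v \<bullet> w)" "v \<bullet> v"] E by auto
  then have "0 < ?z \<bullet> ?z" by simp
  also have "?z \<bullet> ?z = (v \<bullet> v) * ((v \<bullet> v) * (w \<bullet> w) - (v \<bullet> w)\<^sup>2)"
    by (simp add: inner_add_left inner_add_right inner_commute algebra_simps power2_eq_square)
  finally show "(v \<bullet> v) * (w \<bullet> w) - (v \<bullet> w)\<^sup>2 > 0"
    using E by (simp add: zero_less_mult_iff)
qed

text \<open>Cramer's rule for the Gram system. The explicit quotients show that the coordinates of a
  continuous tangent field are continuous.\<close>

lemma tangent_coordinates:
  fixes v w z :: "'a::real_inner"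
  assumes "z \<in> span {v, w}" "(v \<bullet> v) * (w \<bullet> w) - (v \<bullet> w)\<^sup>2 \<noteq> 0"
  shows "z = (((w \<bullet> w) * (z \<bullet> v) - (v \<bullet> w) * (z \<bullet> w)) / ((v \<bullet> v) * (w \<bullet> w) - (v \<bullet> w)\<^sup>2)) *\<^sub>R v
      + (((v \<bullet> v) * (z \<bullet> w) - (v \<bullet> w) * (z \<bullet> v)) / ((v \<bullet> v) * (w \<bullet> w) - (v \<bullet> w)\<^sup>2)) *\<^sub>R w"
proof -
  obtain \<alpha> \<beta> where z: "z = \<alpha> *\<^sub>R v + \<beta> *\<^sub>R w"
    using assms(1) by (auto simp: span_breakdown_eq algebra_simps)
  have "(w \<bullet> w) * (z \<bullet> v) - (v \<bullet> w) * (z \<bullet> w) = \<alpha> * ((v \<bullet> v) * (w \<bullet> w) - (v \<bullet> w)\<^sup>2)"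
    "(v \<bullet> v) * (z \<bullet> w) - (v \<bullet> w) * (z \<bullet> v) = \<beta> * ((v \<bullet> v) * (w \<bullet> w) - (v \<bullet> w)\<^sup>2)"
    unfolding z by (simp_all add: inner_add_left inner_commute[of w v] algebra_simps power2_eq_square)
  then show ?thesis using assms(2) z by simp
qed

text \<open>The frame is only assumed continuous. Near a non-umbilic point smoothness is recovered
  in turn for the principal curvature \<mu>, the coordinates of e1, and those of e2; each time the
  known smooth quantity is a square or product, and continuity fixes the sign.\<close>

lemma smooth_principal_frame:
  assumes surf: "surface_in_S3 U l n" and minimal: "minimal_in_S3 U l n"
    and e1_cont: "continuous_on U e1" and e2_cont: "continuous_on U e2"
    and e1: "\<forall>p\<in>U. principal_direction l n p (e1 p) \<and> norm (e1 p) = 1"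
    and e2: "\<forall>p\<in>U. e2 p \<in> span {pd_u l p, pd_v l p} \<and> norm (e2 p) = 1 \<and> e1 p \<bullet> e2 p = 0"
    and p0: "p0 \<in> U" "gauss_curv l n p0 \<noteq> 1"
  obtains V \<alpha> \<beta> \<gamma> \<delta> \<mu> where "open V" "p0 \<in> V" "V \<subseteq> U"
    "smooth_on V \<alpha>" "smooth_on V \<beta>" "smooth_on V \<gamma>" "smooth_on V \<delta>" "smooth_on V \<mu>"
    "\<And>p. p \<in> V \<Longrightarrow> \<mu> p \<noteq> 0"
    "\<And>p. p \<in> V \<Longrightarrow> dd \<alpha> \<beta> l p = e1 p" "\<And>p. p \<in> V \<Longrightarrow> dd \<gamma> \<delta> l p = e2 p"
    "\<And>p. p \<in> V \<Longrightarrow> sff l n p (\<alpha> p) (\<beta> p) (\<alpha> p) (\<beta> p) = \<mu> p"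
    "\<And>p. p \<in> V \<Longrightarrow> sff l n p (\<alpha> p) (\<beta> p) (\<gamma> p) (\<delta> p) = 0"
    "\<And>p. p \<in> V \<Longrightarrow> sff l n p (\<gamma> p) (\<delta> p) (\<gamma> p) (\<delta> p) = - \<mu> p"
proof -
  have U: "open U" and sl: "smooth_on U l" and sn: "smooth_on U n"
    using surf unfolding surface_in_S3_def by auto
  define E where "E = fE l"
  define F where "F = fF l"
  define G where "G = fG l"
  define L where "L = sL l n"
  define M where "M = sM l n"
  define N where "N = sN l n"
  define D where "D p = E p * G p - (F p)\<^sup>2" for p
  note defs = fE_def fF_def fG_def sL_def sM_def sN_def
  have sm: "smooth_on U E" "smooth_on U F" "smooth_on U G" "smooth_on U L" "smooth_on U M" "smooth_on U N"
    unfolding E_def F_def G_def L_def M_def N_def defs[abs_def]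
    by (intro smooth_on_intros U sl sn)+
  have sD: "smooth_on U D"
    unfolding D_def[abs_def] power2_eq_square by (intro smooth_on_intros U sm)
  have indep: "independent {pd_u l p, pd_v l p}" "pd_u l p \<noteq> pd_v l p" if "p \<in> U" for p
    using surf that unfolding surface_in_S3_def by blast+
  have D: "D p > 0" if "p \<in> U" for p
    using gram_pos(2)[OF indep[OF that]] by (simp add: D_def E_def F_def G_def defs)
  have trace: "E p * N p - 2 * F p * M p + G p * L p = 0" if "p \<in> U" for p
    using minimal that D[OF that] unfolding minimal_in_S3_def mean_curv_def
    by (auto simp: D_def E_def F_def G_def L_def M_def N_def)
  define \<alpha> where "\<alpha> p = (G p * (e1 p \<bullet> pd_u l p) - F p * (e1 p \<bullet> pd_v l p)) / D p" for p
  define \<beta> where "\<beta> p = (E p * (e1 p \<bullet> pd_v l p) - F p * (e1 p \<bullet> pd_u l p)) / D p" for p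
  define \<gamma> where "\<gamma> p = (G p * (e2 p \<bullet> pd_u l p) - F p * (e2 p \<bullet> pd_v l p)) / D p" for p
  define \<delta> where "\<delta> p = (E p * (e2 p \<bullet> pd_v l p) - F p * (e2 p \<bullet> pd_u l p)) / D p" for p
  note cont_sm = smooth_on_imp_continuous_on[OF sm(1)] smooth_on_imp_continuous_on[OF sm(2)]
    smooth_on_imp_continuous_on[OF sm(3)] smooth_on_imp_continuous_on[OF sm(4)]
    smooth_on_imp_continuous_on[OF sm(5)] smooth_on_imp_continuous_on[OF sm(6)]
    smooth_on_imp_continuous_on[OF sD] smooth_on_imp_continuous_on[OF smooth_on_pd(1)[OF sl]]
    smooth_on_imp_continuous_on[OF smooth_on_pd(2)[OF sl]]
  have D0: "\<forall>p\<in>U. D p \<noteq> 0" using D by force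
  have cont: "continuous_on U \<alpha>" "continuous_on U \<beta>" "continuous_on U \<gamma>" "continuous_on U \<delta>"
    unfolding \<alpha>_def[abs_def] \<beta>_def[abs_def] \<gamma>_def[abs_def] \<delta>_def[abs_def]
    by (intro continuous_intros cont_sm e1_cont e2_cont D0)+
  have coord: "z = ((G p * (z \<bullet> pd_u l p) - F p * (z \<bullet> pd_v l p)) / D p) *\<^sub>R pd_u l p +
      ((E p * (z \<bullet> pd_v l p) - F p * (z \<bullet> pd_u l p)) / D p) *\<^sub>R pd_v l p"
    if "p \<in> U" "z \<in> span {pd_u l p, pd_v l p}" for p z
    using tangent_coordinates[OF that(2)] D[OF that(1)]
    by (simp add: D_def E_def F_def G_def defs)
  have e1_eq: "e1 p = \<alpha> p *\<^sub>R pd_u l p + \<beta> p *\<^sub>R pd_v l p" if p: "p \<in> U" for p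
  proof -
    obtain a' b' where "e1 p = a' *\<^sub>R pd_u l p + b' *\<^sub>R pd_v l p"
      using e1 p unfolding principal_direction_def by blast
    then have "e1 p \<in> span {pd_u l p, pd_v l p}" by (simp add: span_add span_scale span_base)
    then show ?thesis using coord[OF p] unfolding \<alpha>_def \<beta>_def by blast
  qed
  have e2_eq: "e2 p = \<gamma> p *\<^sub>R pd_u l p + \<delta> p *\<^sub>R pd_v l p" if "p \<in> U" for p
    using coord[OF that] e2 that unfolding \<gamma>_def \<delta>_def by blast
  have unit: "E p * (\<alpha> p)\<^sup>2 + 2 * F p * \<alpha> p * \<beta> p + G p * (\<beta> p)\<^sup>2 = 1"
    "E p * (\<gamma> p)\<^sup>2 + 2 * F p * \<gamma> p * \<delta> p + G p * (\<delta> p)\<^sup>2 = 1"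
    "E p * \<alpha> p * \<gamma> p + F p * (\<alpha> p * \<delta> p + \<beta> p * \<gamma> p) + G p * \<beta> p * \<delta> p = 0" if p: "p \<in> U" for p
  proof -
    have "e1 p \<bullet> e1 p = 1" "e2 p \<bullet> e2 p = 1" "e1 p \<bullet> e2 p = 0"
      using e1 e2 p by (simp_all add: norm_eq_1)
    then show "E p * (\<alpha> p)\<^sup>2 + 2 * F p * \<alpha> p * \<beta> p + G p * (\<beta> p)\<^sup>2 = 1"
      "E p * (\<gamma> p)\<^sup>2 + 2 * F p * \<gamma> p * \<delta> p + G p * (\<delta> p)\<^sup>2 = 1"
      "E p * \<alpha> p * \<gamma> p + F p * (\<alpha> p * \<delta> p + \<beta> p * \<gamma> p) + G p * \<beta> p * \<delta> p = 0"
      unfolding e1_eq[OF p] e2_eq[OF p]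
      by (simp_all add: E_def F_def G_def defs inner_add_left inner_add_right
          inner_commute[of "pd_v l p" "pd_u l p"] power2_eq_square algebra_simps)
  qed
  define \<mu> where "\<mu> p = sff l n p (\<alpha> p) (\<beta> p) (\<alpha> p) (\<beta> p)" for p
  have eig: "L p * \<alpha> p + M p * \<beta> p = \<mu> p * (E p * \<alpha> p + F p * \<beta> p)"
    "M p * \<alpha> p + N p * \<beta> p = \<mu> p * (F p * \<alpha> p + G p * \<beta> p)" if p: "p \<in> U" for p
  proof -
    obtain a' b' r where *: "e1 p = a' *\<^sub>R pd_u l p + b' *\<^sub>R pd_v l p"
      "L p * a' + M p * b' = r * (E p * a' + F p * b')" "M p * a' + N p * b' = r * (F p * a' + G p * b')"
      using e1 p unfolding principal_direction_def L_def M_def N_def E_def F_def G_def by blast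
    have "(\<alpha> p - a') *\<^sub>R pd_u l p + (\<beta> p - b') *\<^sub>R pd_v l p = 0"
      using *(1) e1_eq[OF p] by (simp add: algebra_simps)
    then have ab: "a' = \<alpha> p" "b' = \<beta> p"
      using independent_pairD[OF indep[OF p]] by (metis eq_iff_diff_eq_0)+
    \<comment> \<open>Pairing the eigenvector equations with the unit vector e1 identifies the
      eigenvalue.\<close>
    have "\<mu> p = r"
      using *(2,3) unit(1)[OF p] unfolding ab \<mu>_def sff_def L_def[symmetric] M_def[symmetric] N_def[symmetric]
      by algebra
    then show "L p * \<alpha> p + M p * \<beta> p = \<mu> p * (E p * \<alpha> p + F p * \<beta> p)"
      "M p * \<alpha> p + N p * \<beta> p = \<mu> p * (F p * \<alpha> p + G p * \<beta> p)"
      using *(2,3) ab by simp_all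
  qed
  note ev = traceless_eigenvector[OF unit(1) eig trace, folded D_def]
  note ov = traceless_eigenvector_orthogonal[OF unit eig trace, folded D_def]
  \<comment> \<open>The eigenvalues are opposite, so det II / det I is minus the square of \<mu>;
    this square is smooth before \<mu> is known to be.\<close>
  have \<mu>sq: "smooth_on U (\<lambda>p. \<mu> p * \<mu> p)"
  proof (rule smooth_on_cong[OF U])
    show "smooth_on U (\<lambda>p. (M p * M p - L p * N p) / D p)"
      using D0 by (intro smooth_on_divide smooth_on_intros U sm sD) blast
    show "(M p * M p - L p * N p) / D p = \<mu> p * \<mu> p" if "p \<in> U" for p
      using ev(1)[OF that that that that] D[OF that] by (simp add: field_simps power2_eq_square)
  qed
  have "continuous_on U \<mu>"
    unfolding \<mu>_def[abs_def] sff_def L_def[symmetric] M_def[symmetric] N_def[symmetric]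
    by (intro continuous_intros cont_sm cont)
  \<comment> \<open>If \<mu> vanished, so would det II, and the Gauss equation would give curvature
    1.\<close>
  moreover have "\<mu> p0 \<noteq> 0"
  proof
    assume "\<mu> p0 = 0"
    then have "L p0 * N p0 - (M p0)\<^sup>2 = 0" using ev(1)[OF p0(1) p0(1) p0(1) p0(1)] by simp
    then show False using p0(2) by (simp add: gauss_curv_def L_def M_def N_def)
  qed
  ultimately have "\<exists>W. open W \<and> p0 \<in> W \<and> W \<subseteq> U \<and> smooth_on W \<mu> \<and> (\<forall>x\<in>W. \<mu> x \<noteq> 0)"
    by (intro smooth_on_of_square[OF U _ \<mu>sq p0(1)])
  then obtain V1 where "open V1 \<and> p0 \<in> V1 \<and> V1 \<subseteq> U \<and> smooth_on V1 \<mu> \<and> (\<forall>x\<in>V1. \<mu> x \<noteq> 0)" ..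
  then have V1: "open V1" "p0 \<in> V1" "V1 \<subseteq> U" "smooth_on V1 \<mu>" "\<And>p. p \<in> V1 \<Longrightarrow> \<mu> p \<noteq> 0"
    by simp_all
  note sm1 = sm[THEN smooth_on_subset, OF V1(3)] sD[THEN smooth_on_subset, OF V1(3)]
  have den: "2 * \<mu> p * D p \<noteq> 0" if "p \<in> V1" for p
    using V1(5)[OF that] D[OF subsetD[OF V1(3) that]] by simp
  have sq: "smooth_on V1 (\<lambda>p. \<alpha> p * \<alpha> p)" "smooth_on V1 (\<lambda>p. \<beta> p * \<beta> p)" "smooth_on V1 (\<lambda>p. \<alpha> p * \<beta> p)"
  proof -
    have "smooth_on V1 (\<lambda>p. (\<mu> p * G p - N p) / (2 * \<mu> p * D p))"
      "smooth_on V1 (\<lambda>p. (\<mu> p * E p - L p) / (2 * \<mu> p * D p))"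
      "smooth_on V1 (\<lambda>p. (M p - \<mu> p * F p) / (2 * \<mu> p * D p))"
      by (intro smooth_on_divide smooth_on_intros V1(1,4) sm1 den; assumption)+
    moreover have "(\<mu> p * G p - N p) / (2 * \<mu> p * D p) = \<alpha> p * \<alpha> p"
      "(\<mu> p * E p - L p) / (2 * \<mu> p * D p) = \<beta> p * \<beta> p"
      "(M p - \<mu> p * F p) / (2 * \<mu> p * D p) = \<alpha> p * \<beta> p" if "p \<in> V1" for p
    proof -
      have p: "p \<in> U" using that V1(3) by blast
      from ev(2-4)[OF p p p p, symmetric] den[OF that]
      show "(\<mu> p * G p - N p) / (2 * \<mu> p * D p) = \<alpha> p * \<alpha> p"
        "(\<mu> p * E p - L p) / (2 * \<mu> p * D p) = \<beta> p * \<beta> p"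
        "(M p - \<mu> p * F p) / (2 * \<mu> p * D p) = \<alpha> p * \<beta> p"
        by (simp_all add: power2_eq_square)
    qed
    ultimately show "smooth_on V1 (\<lambda>p. \<alpha> p * \<alpha> p)" "smooth_on V1 (\<lambda>p. \<beta> p * \<beta> p)"
      "smooth_on V1 (\<lambda>p. \<alpha> p * \<beta> p)"
      using smooth_on_cong[OF V1(1)] by (metis (no_types, lifting))+
  qed
  note cont1 = cont[THEN continuous_on_subset, OF V1(3)]
  \<comment> \<open>One coordinate of e1 is nonzero at p0 and is smooth through its square; the
    other is the smooth product of both divided by it.\<close>
  have "\<exists>V2. open V2 \<and> p0 \<in> V2 \<and> V2 \<subseteq> V1 \<and> smooth_on V2 \<alpha> \<and> smooth_on V2 \<beta>"
  proof (cases "\<alpha> p0 = 0")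
    case False
    then obtain V2 where V2: "open V2" "p0 \<in> V2" "V2 \<subseteq> V1" "smooth_on V2 \<alpha>" "\<And>p. p \<in> V2 \<Longrightarrow> \<alpha> p \<noteq> 0"
      using smooth_on_of_square[OF V1(1) cont1(1) sq(1) V1(2)] by blast
    have "smooth_on V2 (\<lambda>p. (\<alpha> p * \<beta> p) / \<alpha> p)"
      by (intro smooth_on_divide V2 smooth_on_subset[OF sq(3)])
    then have "smooth_on V2 \<beta>" by (rule smooth_on_cong[OF V2(1)]) (simp add: V2(5))
    then show ?thesis using V2 by blast
  next
    case True
    then have "\<beta> p0 \<noteq> 0" using unit(1)[OF p0(1)] by auto
    then obtain V2 where V2: "open V2" "p0 \<in> V2" "V2 \<subseteq> V1" "smooth_on V2 \<beta>" "\<And>p. p \<in> V2 \<Longrightarrow> \<beta> p \<noteq> 0"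
      using smooth_on_of_square[OF V1(1) cont1(2) sq(2) V1(2)] by blast
    have "smooth_on V2 (\<lambda>p. (\<alpha> p * \<beta> p) / \<beta> p)"
      by (intro smooth_on_divide V2 smooth_on_subset[OF sq(3)])
    then have "smooth_on V2 \<alpha>" by (rule smooth_on_cong[OF V2(1)]) (simp add: V2(5))
    then show ?thesis using V2 by blast
  qed
  then obtain V2 where V2: "open V2" "p0 \<in> V2" "V2 \<subseteq> V1" "smooth_on V2 \<alpha>" "smooth_on V2 \<beta>" by blast
  have V2U: "V2 \<subseteq> U" using V2 V1 by blast
  \<comment> \<open>The determinant of the frame coordinates. Its square is 1/D, so t is smooth, and
    it expresses e2 as the rotation of e1.\<close>
  define t where "t p = \<alpha> p * \<delta> p - \<beta> p * \<gamma> p" for p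
  note ov' = ov[folded t_def]
  have tsq: "t p * t p = 1 / D p" if p: "p \<in> U" for p
    using ov'(3)[OF p p p p p p] D[OF p] by (simp add: field_simps power2_eq_square)
  have "smooth_on V2 (\<lambda>p. 1 / D p)"
    using D0 V2U by (intro smooth_on_divide smooth_on_const V2 smooth_on_subset[OF sD]) blast+
  then have "smooth_on V2 (\<lambda>p. t p * t p)"
    by (rule smooth_on_cong[OF V2(1)]) (use tsq V2U in \<open>metis subsetD\<close>)
  moreover have "continuous_on V2 t"
    unfolding t_def[abs_def] by (intro continuous_intros cont[THEN continuous_on_subset, OF V2U])
  moreover have "t p0 \<noteq> 0" using tsq[OF p0(1)] D[OF p0(1)] by auto
  ultimately have "\<exists>W. open W \<and> p0 \<in> W \<and> W \<subseteq> V2 \<and> smooth_on W t \<and> (\<forall>x\<in>W. t x \<noteq> 0)"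
    by (intro smooth_on_of_square[OF V2(1) _ _ V2(2)])
  then obtain V where V: "open V" "p0 \<in> V" "V \<subseteq> V2" "smooth_on V t"
    by blast
  have VU: "V \<subseteq> U" "V \<subseteq> V1" using V V2 V2U by blast+
  have s\<alpha>\<beta>: "smooth_on V \<alpha>" "smooth_on V \<beta>" using V2 V smooth_on_subset by blast+
  note smV = sm[THEN smooth_on_subset, OF VU(1)]
  have s\<gamma>\<delta>: "smooth_on V \<gamma>" "smooth_on V \<delta>"
  proof -
    have "smooth_on V (\<lambda>p. - t p * (F p * \<alpha> p + G p * \<beta> p))" "smooth_on V (\<lambda>p. t p * (E p * \<alpha> p + F p * \<beta> p))"
      by (intro smooth_on_intros V s\<alpha>\<beta> smV)+
    moreover have "- t p * (F p * \<alpha> p + G p * \<beta> p) = \<gamma> p" "t p * (E p * \<alpha> p + F p * \<beta> p) = \<delta> p"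
      if "p \<in> V" for p
    proof -
      have p: "p \<in> U" using that VU by blast
      show "- t p * (F p * \<alpha> p + G p * \<beta> p) = \<gamma> p" "t p * (E p * \<alpha> p + F p * \<beta> p) = \<delta> p"
        using ov'(1,2)[OF p p p p p p] by simp_all
    qed
    ultimately show "smooth_on V \<gamma>" "smooth_on V \<delta>"
      using smooth_on_cong[OF V(1)] by (metis (no_types, lifting))+
  qed
  show thesis
  proof (rule that[of V \<alpha> \<beta> \<gamma> \<delta> \<mu>])
    show "open V" "p0 \<in> V" "V \<subseteq> U" "smooth_on V \<alpha>" "smooth_on V \<beta>" "smooth_on V \<gamma>" "smooth_on V \<delta>"
      by (fact V VU s\<alpha>\<beta> s\<gamma>\<delta>)+
    show "smooth_on V \<mu>" using V1(4) VU(2) smooth_on_subset by blast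
    fix p assume pV: "p \<in> V"
    then have p: "p \<in> U" "p \<in> V1" using VU by blast+
    show "\<mu> p \<noteq> 0" using V1(5) p by blast
    show "dd \<alpha> \<beta> l p = e1 p" "dd \<gamma> \<delta> l p = e2 p" using e1_eq e2_eq p by (simp_all add: dd_def)
    show "sff l n p (\<alpha> p) (\<beta> p) (\<alpha> p) (\<beta> p) = \<mu> p" by (simp add: \<mu>_def)
    show "sff l n p (\<alpha> p) (\<beta> p) (\<gamma> p) (\<delta> p) = 0" "sff l n p (\<gamma> p) (\<delta> p) (\<gamma> p) (\<delta> p) = - \<mu> p"
      using ov(4,5)[OF p(1) p(1) p(1) p(1) p(1) p(1)]
      by (simp_all add: sff_def L_def M_def N_def)
  qed
qed

section \<open>The possible angles\<close>

lemma is_circle_subset: "is_circle I g \<Longrightarrow> J \<subseteq> I \<Longrightarrow> is_circle J g"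
  unfolding is_circle_def by blast

text \<open>The angle \<theta> is an arbitrary real number: even j means that the circles are
  principal lines, odd j that they are bisectrices.\<close>

theorem theorem2p2:
  fixes U :: "(real \<times> real) set"
    and l n e1 e2 :: "real \<times> real \<Rightarrow> real^4"
    and \<theta> :: real
  assumes surf: "surface_in_S3 U l n"
    and minimal: "minimal_in_S3 U l n"
    and K_nonconst: "\<not> (\<exists>k. \<forall>p\<in>U. gauss_curv l n p = k)"
    and e1_cont: "continuous_on U e1"
    and e2_cont: "continuous_on U e2"
    and e1_principal: "\<forall>p\<in>U. principal_direction l n p (e1 p) \<and> norm (e1 p) = 1"
    and e2_other: "\<forall>p\<in>U. e2 p \<in> span {pd_u l p, pd_v l p} \<and> norm (e2 p) = 1 \<and> e1 p \<bullet> e2 p = 0"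
    and circles: "\<forall>p\<in>U. \<exists>c :: real \<Rightarrow> real \<times> real. \<exists>a b t0.
        a < t0 \<and> t0 < b \<and> c t0 = p \<and> c ` {a<..<b} \<subseteq> U \<and>
        (\<forall>t\<in>{a<..<b}. c differentiable at t) \<and>
        is_circle {a<..<b} (l \<circ> c) \<and>
        (\<forall>t\<in>{a<..<b}. (1 / norm (vd (l \<circ> c) t)) *\<^sub>R vd (l \<circ> c) t
                          = cos \<theta> *\<^sub>R e1 (c t) + sin \<theta> *\<^sub>R e2 (c t))"
  shows "\<exists>j::int. \<theta> = of_int j * pi / 4"
proof -
  \<comment> \<open>A non-constant curvature is not identically 1, so some point is not
    umbilic.\<close>
  from K_nonconst obtain p0 where p0: "p0 \<in> U" "gauss_curv l n p0 \<noteq> 1" by blast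
  obtain V \<alpha> \<beta> \<gamma> \<delta> \<mu> where V0: "open V" "p0 \<in> V" "V \<subseteq> U"
    and s: "smooth_on V \<alpha>" "smooth_on V \<beta>" "smooth_on V \<gamma>" "smooth_on V \<delta>" "smooth_on V \<mu>"
    and \<mu>: "\<And>p. p \<in> V \<Longrightarrow> \<mu> p \<noteq> 0"
    and e: "\<And>p. p \<in> V \<Longrightarrow> dd \<alpha> \<beta> l p = e1 p" "\<And>p. p \<in> V \<Longrightarrow> dd \<gamma> \<delta> l p = e2 p"
    and II: "\<And>p. p \<in> V \<Longrightarrow> sff l n p (\<alpha> p) (\<beta> p) (\<alpha> p) (\<beta> p) = \<mu> p"
    "\<And>p. p \<in> V \<Longrightarrow> sff l n p (\<alpha> p) (\<beta> p) (\<gamma> p) (\<delta> p) = 0"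
    "\<And>p. p \<in> V \<Longrightarrow> sff l n p (\<gamma> p) (\<delta> p) (\<gamma> p) (\<delta> p) = - \<mu> p"
    by (rule smooth_principal_frame[OF surf minimal e1_cont e2_cont e1_principal e2_other p0]) blast
  \<comment> \<open>The principal frame rotated by \<theta>: X is the unit tangent of the circles, Y
    completes it.\<close>
  define x1 where "x1 p = cos \<theta> * \<alpha> p + sin \<theta> * \<gamma> p" for p
  define x2 where "x2 p = cos \<theta> * \<beta> p + sin \<theta> * \<delta> p" for p
  define y1 where "y1 p = - sin \<theta> * \<alpha> p + cos \<theta> * \<gamma> p" for p
  define y2 where "y2 p = - sin \<theta> * \<beta> p + cos \<theta> * \<delta> p" for p
  have sl: "smooth_on V l" and sn: "smooth_on V n"
    using surf V0(3) smooth_on_subset unfolding surface_in_S3_def by blast+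
  have sxy: "smooth_on V x1" "smooth_on V x2" "smooth_on V y1" "smooth_on V y2"
    unfolding x1_def[abs_def] x2_def[abs_def] y1_def[abs_def] y2_def[abs_def]
    by (intro smooth_on_intros V0(1) s)+
  have X: "dd x1 x2 l p = cos \<theta> *\<^sub>R e1 p + sin \<theta> *\<^sub>R e2 p"
    and Y: "dd y1 y2 l p = - sin \<theta> *\<^sub>R e1 p + cos \<theta> *\<^sub>R e2 p" if "p \<in> V" for p
    using e[OF that, symmetric] by (simp_all add: dd_def x1_def x2_def y1_def y2_def algebra_simps)
  have nrm: "n p \<bullet> pd_u l p = 0" "n p \<bullet> pd_v l p = 0" "l p \<bullet> l p = 1" "n p \<bullet> n p = 1" "n p \<bullet> l p = 0"
    and ind: "independent {pd_u l p, pd_v l p}" "pd_u l p \<noteq> pd_v l p" if "p \<in> V" for p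
    using surf that V0(3) unfolding surface_in_S3_def by blast+
  \<comment> \<open>In the principal frame the form is diagonal with entries \<mu> and -\<mu>;
    rotating it by \<theta> produces the double angle.\<close>
  have sff_xy: "sff l n p (x1 p) (x2 p) (x1 p) (x2 p) = cos (2 * \<theta>) * \<mu> p"
    "sff l n p (x1 p) (x2 p) (y1 p) (y2 p) = - sin (2 * \<theta>) * \<mu> p"
    "sff l n p (y1 p) (y2 p) (y1 p) (y2 p) = - cos (2 * \<theta>) * \<mu> p" if p: "p \<in> V" for p
    unfolding x1_def x2_def y1_def y2_def sff_bilinear II[OF p] cos_double sin_double
    by (simp_all add: power2_eq_square algebra_simps)
  note dd2 = dd_dd_inner_normal[where n = n, OF V0(1) _ sl]
  interpret minimal_frame V l n x1 x2 y1 y2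
  proof
    fix p assume p: "p \<in> V"
    have "e1 p \<bullet> e1 p = 1" "e2 p \<bullet> e2 p = 1" "e1 p \<bullet> e2 p = 0" "e2 p \<bullet> e1 p = 0"
      using e1_principal e2_other p V0(3) by (auto simp: norm_eq_1 inner_commute)
    then show "dd x1 x2 l p \<bullet> dd x1 x2 l p = 1" "dd y1 y2 l p \<bullet> dd y1 y2 l p = 1"
      "dd x1 x2 l p \<bullet> dd y1 y2 l p = 0"
      unfolding X[OF p] Y[OF p]
      by (simp_all add: inner_add_left inner_add_right inner_diff_left inner_diff_right
          power2_eq_square[symmetric])
    show "dd y1 y2 (dd y1 y2 l) p \<bullet> n p = - (dd x1 x2 (dd x1 x2 l) p \<bullet> n p)"
      using dd2[OF p sxy(3,4) nrm(1,2)[OF p]] dd2[OF p sxy(1,2) nrm(1,2)[OF p]] sff_xy[OF p] by simp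
    show "x = 0 \<and> y = 0" if "x *\<^sub>R pd_u l p + y *\<^sub>R pd_v l p = 0" for x y
      using independent_pairD[OF ind[OF p] that] .
  qed (use V0 sl sn sxy nrm in blast)+
  have hk: "h p = cos (2 * \<theta>) * \<mu> p" "k p = - sin (2 * \<theta>) * \<mu> p" if p: "p \<in> V" for p
    using dd2[OF p sxy(1,2) nrm(1,2)[OF p]] dd2[OF p sxy(3,4) nrm(1,2)[OF p]] sff_xy[OF p]
    unfolding h_def k_def by simp_all
  have circ: "D1 a p = h p * k p \<and> D1 h p = - a p * k p" if p: "p \<in> V" for p
  proof -
    from bspec[OF circles subsetD[OF V0(3) p]] obtain c u v t0
      where c: "u < t0" "t0 < v" "c t0 = p" "c ` {u<..<v} \<subseteq> U"
        "\<forall>t\<in>{u<..<v}. c differentiable at t" "is_circle {u<..<v} (l \<circ> c)"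
        "\<forall>t\<in>{u<..<v}. (1 / norm (vd (l \<circ> c) t)) *\<^sub>R vd (l \<circ> c) t
          = cos \<theta> *\<^sub>R e1 (c t) + sin \<theta> *\<^sub>R e2 (c t)"
      by (elim exE conjE)
    \<comment> \<open>The circle through p is only known to stay in U; restricting to the open set
      of parameters that c maps into V keeps t0.\<close>
    define I where "I = {u<..<v} \<inter> c -` V"
    have "continuous_on {u<..<v} c"
      using c(5) by (intro differentiable_imp_continuous_on) (simp add: differentiable_on_def differentiable_at_withinI)
    then have I: "open I" "t0 \<in> I" "c ` I \<subseteq> V" "I \<subseteq> {u<..<v}"
      unfolding I_def using c p by (auto intro!: continuous_open_preimage V0(1))
    have tan: "(1 / norm (vd (l \<circ> c) t)) *\<^sub>R vd (l \<circ> c) t = X (c t)" if "t \<in> I" for t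
      using bspec[OF c(7), of t] X[of "c t"] that subsetD[OF I(4) that] imageI[OF that, of c] I(3) by auto
    have dI: "c differentiable at t" if "t \<in> I" for t using c(5) that I(4) by blast
    show ?thesis
      using circle_conditions[OF I(1,2) dI I(3) is_circle_subset[OF c(6) I(4)] tan] c(3) by simp
  qed
  have "sin (2 * \<theta>) = 0 \<or> cos (2 * \<theta>) = 0"
    by (rule circle_angle_rigidity[OF _ _ s(5) \<mu> hk]) (use V0(2) circ in auto)
  \<comment> \<open>Both alternatives amount to sin 4\<theta> = 0.\<close>
  then have "sin (2 * (2 * \<theta>)) = 0" unfolding sin_double[of "2 * \<theta>"] by auto
  then obtain j :: int where "2 * (2 * \<theta>) = of_int j * pi"
    using sin_zero_iff_int2 by blast
  then have "\<theta> = of_int j * pi / 4" by simp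
  then show ?thesis by blast
qed

end
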